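(* Assume that, for each $i=1,\dots,K$, the Hamiltonian $H_i$ is coercive, i.e. $H_i(p_i,x_i)\to\infty$ as $|p_i|\to\infty$ uniformly for $x_i\in\bar I_i$. Then: (i) If $v,u\in C(\bar I)$ are respectively a state-constraint sub-solution and a state-constraint super-solution to the junction problem, then $v\le u$ on $\bar I$. (ii) There exists a unique state-constraint solution $\hat u$ of the junction problem. (iii) $\hat u(0)=\min_{1\le i\le K}u^{sc,i}(0)$, where $u^{sc,i}$ is the state-constraint solution to $w+H_i(w_{x_i},x_i)=0$ on $\bar I_i$.
   Context: Junction. Let $K$ be a positive integer and, for $i=1,\dots,K$, $I_i:=(-a_i,0)$ with $a_i\in(0,\infty]$. $I:=\bigcup_{i=1}^K I_i$, where the $I_i$ are regarded as distinct branches (the $i$-th one lying on the $i$-th coordinate axis of $\mathbb R^K$), and in $\bar I$ all branches are glued at the common point $0$, the junction. For $u\in C(\bar I;\mathbb R)$, $u_i$ (often written $u$) is the restriction of $u$ to $\bar I_i$ as a function of $x_i$; all $u_i$ take the same value $u(0)$ at $0$. $u_{x_i}$ denotes the derivative of $u_i$ in $x_i$. The Hamiltonians $H_i:\mathbb R\times\bar I_i\to\mathbb R$ are continuous. No convexity is assumed. Definitions (all inequalities in the viscosity sense). $u\in C(\bar I)$ is a state-constraint sub-solution to the junction problem if $u_i+H_i(u_{x_i},x_i)\le0$ in $I_i$ for each $i$ (no condition at $0$). $u\in C(\bar I)$ is a state-constraint super-solution if $u_i+H_i(u_{x_i},x_i)\ge0$ in $I_i$ for each $i$, and $u(0)+\max_{1\le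 i\le K}H_i(u_{x_i},0)\ge0$ at the junction, meaning: whenever $\phi$ is continuous on $\bar I$, with each $\phi_i$ being $C^1$ on $I_i\cup\{0\}$ (one-sided derivative at $0$), and $u-\phi$ has a (strict) local minimum at $0$ relative to $\bar I$, then $u(0)+\max_{1\le i\le K}H_i(\phi_{x_i}(0),0)\ge0$. A state-constraint solution is a function which is both. State-constraint solution on one branch. $u^{sc,i}\in C(\bar I_i)$ denotes the unique state-constraint solution of $w+H_i(w_{x_i},x_i)=0$ on $\bar I_i$, i.e. a viscosity sub-solution in $I_i$ and a viscosity super-solution in $I_i\cup\{0\}$ (at $0$ tested by $C^1$ functions $\phi$ such that $w-\phi$ has a local minimum at $0$ relative to $I_i\cup\{0\}$). Boundary conditions at the end points. At each end point $x_i=-a_i$ a boundary condition (Dirichlet, Neumann or state-constraint, in the viscosity sense) is fixed, and all sub-, super-solutions and solutions (including $u^{sc,i}$) are understood to satisfy it. It may be any condition for which comparison holds for the single-branch equation $w+H_i(w_{x_i},x_i)=0$ in $I_i$: a sub-solution lies below a super-solution on $\bar I_i$ as soon as this is so at $x_i=0$, or as soon as the super-solution is a state-constraint super-solution up to $x_i=0$. *)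

theory Defs
  imports "HOL-Analysis.Analysis" "HOL-Library.Landau_Symbols"
begin

definition branch :: "ereal \<Rightarrow> real set" where
  "branch a = {x. - a < ereal x \<and> x < 0}"

definition cbranch :: "ereal \<Rightarrow> real set" where
  "cbranch a = {x. - a \<le> ereal x \<and> x \<le> 0}"

text \<open>The closed junction, as a subset of Euclidean space with one coordinate axis per branch.
  The index type \<open>'k\<close> is finite and nonempty, and its cardinality is the number of branches.\<close>

definition junction :: "('k::finite \<Rightarrow> ereal) \<Rightarrow> (real ^ 'k) set" where
  "junction a = (\<Union>i. (\<lambda>x. axis i x) ` cbranch (a i))"

definition restr :: "(real ^ 'k \<Rightarrow> real) \<Rightarrow> 'k::finite \<Rightarrow> real \<Rightarrow> real" where
  "restr u i x = u (axis i x)"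

text \<open>At an end point contained in \<open>S\<close>, the derivative within \<open>S\<close> is the one-sided one.\<close>

definition C1_on :: "real set \<Rightarrow> (real \<Rightarrow> real) \<Rightarrow> (real \<Rightarrow> real) \<Rightarrow> bool" where
  "C1_on S \<phi> \<phi>' \<longleftrightarrow>
     (\<forall>x\<in>S. (\<phi> has_real_derivative \<phi>' x) (at x within S)) \<and> continuous_on S \<phi>'"

text \<open>\<open>p\<close> is the slope at \<open>x\<close> of a \<open>C\<^sup>1\<close> function \<open>\<phi>\<close> on \<open>S\<close> such that \<open>u - \<phi>\<close> has a local
  maximum (respectively minimum) at \<open>x\<close> relative to \<open>S\<close>.\<close>

definition slope_above :: "real set \<Rightarrow> (real \<Rightarrow> real) \<Rightarrow> real \<Rightarrow> real \<Rightarrow> bool" where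
  "slope_above S u x p \<longleftrightarrow>
     (\<exists>\<phi> \<phi>'. C1_on S \<phi> \<phi>' \<and> \<phi>' x = p \<and>
        (\<forall>\<^sub>F y in at x within S. u y - \<phi> y \<le> u x - \<phi> x))"

definition slope_below :: "real set \<Rightarrow> (real \<Rightarrow> real) \<Rightarrow> real \<Rightarrow> real \<Rightarrow> bool" where
  "slope_below S u x p \<longleftrightarrow>
     (\<exists>\<phi> \<phi>'. C1_on S \<phi> \<phi>' \<and> \<phi>' x = p \<and>
        (\<forall>\<^sub>F y in at x within S. u y - \<phi> y \<ge> u x - \<phi> x))"

datatype end_cond = Dirichlet real | Neumann real | State_Constraint

text \<open>At a finite end point the conditions are the usual viscosity ones: either the boundary
  inequality or the equation's inequality holds. \<open>Neumann h\<close> prescribes the derivative in the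
  outward direction, which at \<open>- a\<close> is \<open>- p\<close>. On an unbounded branch the condition is that
  of growth at most \<open>1 + \<bar>g\<bar>\<close> at \<open>-\<infinity>\<close> (boundedness when \<open>g = 0\<close>), and \<open>b\<close> is ignored;
  on a bounded branch \<open>g\<close> is ignored.\<close>

definition end_sub ::
  "ereal \<Rightarrow> (real \<Rightarrow> real \<Rightarrow> real) \<Rightarrow> end_cond \<Rightarrow> (real \<Rightarrow> real) \<Rightarrow> (real \<Rightarrow> real) \<Rightarrow> bool" where
  "end_sub a H b g v \<longleftrightarrow>
     (if a = \<infinity> then v \<in> O[at_bot](\<lambda>x. 1 + \<bar>g x\<bar>)
      else let z = - real_of_ereal a in
        \<forall>p. slope_above (insert z (branch a)) v z p \<longrightarrow>
          (case b of
             Dirichlet d \<Rightarrow> v z \<le> d \<or> v z + H p z \<le> 0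
           | Neumann h \<Rightarrow> - p \<le> h \<or> v z + H p z \<le> 0
           | State_Constraint \<Rightarrow> True))"

definition end_super ::
  "ereal \<Rightarrow> (real \<Rightarrow> real \<Rightarrow> real) \<Rightarrow> end_cond \<Rightarrow> (real \<Rightarrow> real) \<Rightarrow> (real \<Rightarrow> real) \<Rightarrow> bool" where
  "end_super a H b g u \<longleftrightarrow>
     (if a = \<infinity> then u \<in> O[at_bot](\<lambda>x. 1 + \<bar>g x\<bar>)
      else let z = - real_of_ereal a in
        \<forall>p. slope_below (insert z (branch a)) u z p \<longrightarrow>
          (case b of
             Dirichlet d \<Rightarrow> u z \<ge> d \<or> u z + H p z \<ge> 0
           | Neumann h \<Rightarrow> - p \<ge> h \<or> u z + H p z \<ge> 0
           | State_Constraint \<Rightarrow> u z + H p z \<ge> 0))"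

text \<open>No condition at \<open>0\<close> in the next two definitions.\<close>

definition branch_sub ::
  "ereal \<Rightarrow> (real \<Rightarrow> real \<Rightarrow> real) \<Rightarrow> end_cond \<Rightarrow> (real \<Rightarrow> real) \<Rightarrow> (real \<Rightarrow> real) \<Rightarrow> bool" where
  "branch_sub a H b g v \<longleftrightarrow>
     continuous_on (cbranch a) v \<and>
     (\<forall>x\<in>branch a. \<forall>p. slope_above (branch a) v x p \<longrightarrow> v x + H p x \<le> 0) \<and>
     end_sub a H b g v"

definition branch_super ::
  "ereal \<Rightarrow> (real \<Rightarrow> real \<Rightarrow> real) \<Rightarrow> end_cond \<Rightarrow> (real \<Rightarrow> real) \<Rightarrow> (real \<Rightarrow> real) \<Rightarrow> bool" where
  "branch_super a H b g u \<longleftrightarrow>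
     continuous_on (cbranch a) u \<and>
     (\<forall>x\<in>branch a. \<forall>p. slope_below (branch a) u x p \<longrightarrow> u x + H p x \<ge> 0) \<and>
     end_super a H b g u"

definition branch_sc_super ::
  "ereal \<Rightarrow> (real \<Rightarrow> real \<Rightarrow> real) \<Rightarrow> end_cond \<Rightarrow> (real \<Rightarrow> real) \<Rightarrow> (real \<Rightarrow> real) \<Rightarrow> bool" where
  "branch_sc_super a H b g u \<longleftrightarrow>
     branch_super a H b g u \<and>
     (\<forall>p. slope_below (insert 0 (branch a)) u 0 p \<longrightarrow> u 0 + H p 0 \<ge> 0)"

definition branch_sc_solution ::
  "ereal \<Rightarrow> (real \<Rightarrow> real \<Rightarrow> real) \<Rightarrow> end_cond \<Rightarrow> (real \<Rightarrow> real) \<Rightarrow> (real \<Rightarrow> real) \<Rightarrow> bool" where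
  "branch_sc_solution a H b g w \<longleftrightarrow> branch_sub a H b g w \<and> branch_sc_super a H b g w"

definition branch_comparison ::
  "ereal \<Rightarrow> (real \<Rightarrow> real \<Rightarrow> real) \<Rightarrow> end_cond \<Rightarrow> (real \<Rightarrow> real) \<Rightarrow> bool" where
  "branch_comparison a H b g \<longleftrightarrow>
     (\<forall>v u. branch_sub a H b g v \<and> branch_super a H b g u \<and>
        (v 0 \<le> u 0 \<or> branch_sc_super a H b g u) \<longrightarrow> (\<forall>x\<in>cbranch a. v x \<le> u x))"

definition coercive :: "ereal \<Rightarrow> (real \<Rightarrow> real \<Rightarrow> real) \<Rightarrow> bool" where
  "coercive a H \<longleftrightarrow> (\<forall>M. \<exists>R. \<forall>p. \<bar>p\<bar> \<ge> R \<longrightarrow> (\<forall>x\<in>cbranch a. H p x \<ge> M))"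

definition junction_sub ::
  "('k::finite \<Rightarrow> ereal) \<Rightarrow> ('k \<Rightarrow> real \<Rightarrow> real \<Rightarrow> real) \<Rightarrow> ('k \<Rightarrow> end_cond) \<Rightarrow>
     ('k \<Rightarrow> real \<Rightarrow> real) \<Rightarrow> (real ^ 'k \<Rightarrow> real) \<Rightarrow> bool" where
  "junction_sub a H b g v \<longleftrightarrow>
     continuous_on (junction a) v \<and> (\<forall>i. branch_sub (a i) (H i) (b i) (g i) (restr v i))"

definition junction_super ::
  "('k::finite \<Rightarrow> ereal) \<Rightarrow> ('k \<Rightarrow> real \<Rightarrow> real \<Rightarrow> real) \<Rightarrow> ('k \<Rightarrow> end_cond) \<Rightarrow>
     ('k \<Rightarrow> real \<Rightarrow> real) \<Rightarrow> (real ^ 'k \<Rightarrow> real) \<Rightarrow> bool" where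
  "junction_super a H b g u \<longleftrightarrow>
     continuous_on (junction a) u \<and> (\<forall>i. branch_super (a i) (H i) (b i) (g i) (restr u i)) \<and>
     (\<forall>\<phi> \<phi>'. continuous_on (junction a) \<phi> \<and>
        (\<forall>i. C1_on (insert 0 (branch (a i))) (restr \<phi> i) (\<phi>' i)) \<and>
        (\<forall>\<^sub>F y in at 0 within junction a. u y - \<phi> y \<ge> u 0 - \<phi> 0) \<longrightarrow>
        u 0 + (MAX i. H i (\<phi>' i 0) 0) \<ge> 0)"

definition junction_solution ::
  "('k::finite \<Rightarrow> ereal) \<Rightarrow> ('k \<Rightarrow> real \<Rightarrow> real \<Rightarrow> real) \<Rightarrow> ('k \<Rightarrow> end_cond) \<Rightarrow>
     ('k \<Rightarrow> real \<Rightarrow> real) \<Rightarrow> (real ^ 'k \<Rightarrow> real) \<Rightarrow> bool" where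
  "junction_solution a H b g u \<longleftrightarrow> junction_sub a H b g u \<and> junction_super a H b g u"

end

theory Submission
  imports Defs
begin

text \<open>
  Everything is governed by the values at the junction. A sub-solution of the junction problem is,
  on each branch, a sub-solution without condition at \<open>0\<close>, so comparison with the state-constraint
  solution of that branch bounds its value at the junction by the minimum of the single-branch
  values. For a super-solution \<open>u\<close> the opposite bound holds. If \<open>u 0\<close> were below all single-branch
  values, then by comparison no restriction of \<open>u\<close> could be a state-constraint super-solution, so
  on each branch some test function touches \<open>u\<close> from below at \<open>0\<close> with \<open>u 0 + H < 0\<close>. These test
  functions, shifted to the value \<open>u 0\<close>, glue to a test function on the junction that violates the
  condition with the maximum (\<open>junction_super_ge_some_branch\<close>). Hence sub-solutions lie below
  super-solutions at the junction, and then everywhere by comparison on the branches; uniqueness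
  and the formula for the value at the junction follow as well.

  For existence let \<open>c\<close> be the minimum of the single-branch values. On a branch where it is attained
  the state-constraint solution itself is used; on any other branch one solves the problem with
  the value \<open>c\<close> prescribed at \<open>0\<close>
  (\<open>branch_solution_with_junction_value\<close>). The glued function is a super-solution at the junction
  because a minimising branch already makes the maximum of the Hamiltonians large enough.

  Single-branch solutions come from Perron's method (\<open>perron_solution\<close>): take the supremum of all
  sub-solutions that lie above a given one and have value at most \<open>c\<close> at \<open>0\<close>. Coercivity makes
  these sub-solutions locally Lipschitz with a common constant, so that the supremum is continuous;
  it is a sub-solution by the usual stability argument, and if it failed to be a super-solution at
  a point, it could be raised there (\<open>bump_subsolution\<close>). At \<open>0\<close> it can be raised as long as its
  value is below \<open>c\<close>. A large \<open>c\<close> therefore gives a state-constraint solution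
  (\<open>branch_sc_solution_exists\<close>, on bounded branches, where explicit barriers are available), and
  a \<open>c\<close> at or below the state-constraint value gives a solution with value \<open>c\<close> at \<open>0\<close>.
\<close>

section \<open>Geometry of a branch\<close>

lemma branch_ereal: "branch (ereal r) = {- r<..<0}"
  by (auto simp: branch_def)

lemma branch_infinity: "branch \<infinity> = {..<0}"
  by (auto simp: branch_def)

lemma cbranch_ereal: "cbranch (ereal r) = {- r..0}"
  by (auto simp: cbranch_def)

lemma cbranch_infinity: "cbranch \<infinity> = {..0}"
  by (auto simp: cbranch_def)

lemmas branch_simps = branch_ereal branch_infinity cbranch_ereal cbranch_infinity

lemma pos_ereal_cases:
  fixes a :: ereal
  assumes "0 < a"
  obtains (finite) r where "a = ereal r" "0 < r" | (infinite) "a = \<infinity>"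
  using assms by (cases a) auto

lemma open_branch: "0 < a \<Longrightarrow> open (branch a)"
  by (erule pos_ereal_cases) (auto simp: branch_simps)

lemma closed_cbranch: "0 < a \<Longrightarrow> closed (cbranch a)"
  by (erule pos_ereal_cases) (auto simp: branch_simps)

lemma branch_subset_cbranch: "branch a \<subseteq> cbranch a"
  by (auto simp: branch_def cbranch_def)

lemma zero_in_cbranch: "0 < a \<Longrightarrow> 0 \<in> cbranch a"
  by (erule pos_ereal_cases) (auto simp: branch_simps)

lemma zero_notin_branch: "0 \<notin> branch a"
  by (auto simp: branch_def)

text \<open>Near each of its points a closed branch agrees with the set on which test functions at that
  point live. This lets interior points, the outer end point and the junction be treated alike.\<close>

lemma cbranch_near:
  assumes "0 < a" "x0 \<in> cbranch a"
  shows "\<exists>r>0. \<forall>y\<in>cbranch a. \<bar>y - x0\<bar> \<le> r \<longrightarrow> y \<in> insert x0 (branch a)"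
  using assms(1)
proof (cases rule: pos_ereal_cases)
  case (finite r)
  define d1 where "d1 = (if x0 = 0 then r / 2 else - x0 / 2)"
  define d2 where "d2 = (if x0 = - r then r / 2 else (x0 + r) / 2)"
  have "- r \<le> x0" "x0 \<le> 0" using assms finite by (auto simp: branch_simps)
  then have "min d1 d2 > 0" 
    using finite by (auto simp: d1_def d2_def)
  moreover have "y \<in> insert x0 (branch a)" if "y \<in> cbranch a" "\<bar>y - x0\<bar> \<le> min d1 d2" for y
    using that \<open>- r \<le> x0\<close> \<open>x0 \<le> 0\<close> finite
    by (auto simp: branch_simps d1_def d2_def abs_le_iff split: if_splits)
  ultimately show ?thesis by blast
next
  case infinite
  define d1 where "d1 = (if x0 = 0 then 1 else - x0 / 2)"
  have "d1 > 0" using assms infinite by (auto simp: branch_simps d1_def)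
  moreover have "y \<in> insert x0 (branch a)" if "y \<in> cbranch a" "\<bar>y - x0\<bar> \<le> d1" for y
    using that infinite
    by (auto simp: branch_simps d1_def abs_le_iff split: if_splits)
  ultimately show ?thesis by blast
qed

lemma cbranch_left_interval:
  assumes "0 < a" "x0 \<in> cbranch a"
  obtains l r where "l < 0" "0 < r" "{l..0} \<subseteq> cbranch a" "{l<..<0} \<subseteq> branch a"
    "\<And>y. y \<in> cbranch a \<Longrightarrow> \<bar>y - x0\<bar> < r \<Longrightarrow> l \<le> y"
  using assms(1)
proof (cases rule: pos_ereal_cases)
  case (finite r)
  then show ?thesis by (intro that[of "- r" 1]) (auto simp: branch_simps)
next
  case infinite
  then show ?thesis using assms
    by (intro that[of "x0 - 1" 1]) (auto simp: branch_simps)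
qed

section \<open>Test slopes\<close>

lemma C1_on_subset: "C1_on S \<phi> \<phi>' \<Longrightarrow> T \<subseteq> S \<Longrightarrow> C1_on T \<phi> \<phi>'"
  unfolding C1_on_def
  by (meson DERIV_subset continuous_on_subset subsetD)

lemma C1_on_continuous_on: "C1_on S \<phi> \<phi>' \<Longrightarrow> continuous_on S \<phi>"
  unfolding C1_on_def by (blast intro: DERIV_continuous_on)

lemma C1_on_add_square:
  assumes "C1_on S \<phi> \<phi>'"
  shows "C1_on S (\<lambda>y. k + \<phi> y + s * (y - x0)\<^sup>2) (\<lambda>y. \<phi>' y + 2 * s * (y - x0))"
proof -
  have "((\<lambda>y. k + \<phi> y + s * (y - x0)\<^sup>2) has_real_derivative \<phi>' x + 2 * s * (x - x0))
      (at x within S)" if "x \<in> S" for x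
  proof -
    have [derivative_intros]: "(\<phi> has_real_derivative \<phi>' x) (at x within S)"
      using assms that by (auto simp: C1_on_def)
    show ?thesis by (auto intro!: derivative_eq_intros)
  qed
  moreover have "continuous_on S (\<lambda>y. \<phi>' y + 2 * s * (y - x0))"
    using assms by (auto simp: C1_on_def intro!: continuous_intros)
  ultimately show ?thesis by (auto simp: C1_on_def)
qed

lemma slope_above_mono:
  assumes "slope_above S v x p" "\<forall>\<^sub>F y in at x within S. w y \<le> v y" "v x = w x"
  shows "slope_above S w x p"
proof -
  obtain \<phi> \<phi>' where "C1_on S \<phi> \<phi>'" "\<phi>' x = p"
    and ev: "\<forall>\<^sub>F y in at x within S. v y - \<phi> y \<le> v x - \<phi> x"
    using assms(1) by (auto simp: slope_above_def)
  moreover have "\<forall>\<^sub>F y in at x within S. w y - \<phi> y \<le> w x - \<phi> x"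
    using ev assms(2) by eventually_elim (use assms(3) in auto)
  ultimately show ?thesis by (auto simp: slope_above_def)
qed

lemma slope_above_minus_const:
  assumes "slope_above S (\<lambda>x. v x - k) x p"
  shows "slope_above S v x p"
proof -
  obtain \<phi> \<phi>' where *: "C1_on S \<phi> \<phi>'" "\<phi>' x = p"
    and ev: "\<forall>\<^sub>F y in at x within S. v y - k - \<phi> y \<le> v x - k - \<phi> x"
    using assms(1) by (auto simp: slope_above_def)
  moreover have "\<forall>\<^sub>F y in at x within S. v y - \<phi> y \<le> v x - \<phi> x"
    using ev by eventually_elim auto
  ultimately show ?thesis by (auto simp: slope_above_def)
qed

lemma derivative_nonneg_right_min:
  fixes f :: "real \<Rightarrow> real"
  assumes "(f has_real_derivative D) (at x within S)" "at_right x \<le> at x within S"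
    "\<forall>\<^sub>F y in at x within S. f x \<le> f y"
  shows "0 \<le> D"
proof (rule tendsto_lowerbound)
  show "((\<lambda>y. (f y - f x) / (y - x)) \<longlongrightarrow> D) (at_right x)"
    using assms(1,2) by (auto simp: has_field_derivative_iff intro: tendsto_mono)
  have "\<forall>\<^sub>F y in at_right x. f x \<le> f y" using assms(2,3) by (auto simp: le_filter_def)
  moreover have "\<forall>\<^sub>F y in at_right x. y > x" by (simp add: eventually_at_right_less)
  ultimately show "\<forall>\<^sub>F y in at_right x. 0 \<le> (f y - f x) / (y - x)"
    by eventually_elim auto
qed auto

lemma derivative_nonpos_left_min:
  fixes f :: "real \<Rightarrow> real"
  assumes "(f has_real_derivative D) (at x within S)" "at_left x \<le> at x within S"
    "\<forall>\<^sub>F y in at x within S. f x \<le> f y"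
  shows "D \<le> 0"
proof (rule tendsto_upperbound)
  show "((\<lambda>y. (f y - f x) / (y - x)) \<longlongrightarrow> D) (at_left x)"
    using assms(1,2) by (auto simp: has_field_derivative_iff intro: tendsto_mono)
  have "\<forall>\<^sub>F y in at_left x. f x \<le> f y" using assms(2,3) by (auto simp: le_filter_def)
  moreover have "\<forall>\<^sub>F y in at_left x. y < x" by (simp add: eventually_at_left_real eventually_at_filter)
  ultimately show "\<forall>\<^sub>F y in at_left x. (f y - f x) / (y - x) \<le> 0"
    by eventually_elim (auto simp: divide_nonneg_neg)
qed auto

text \<open>The two inclusions of filters say that the point can be approached from the right,
  respectively from the left: at an interior point both hold and the slope is determined, while at
  an end point the slope is bounded on one side only.\<close>

lemma slope_above_derivative:
  assumes "slope_above S \<psi> x q" "(\<psi> has_real_derivative d) (at x within S)" "x \<in> S"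
  shows "at_right x \<le> at x within S \<Longrightarrow> d \<le> q" "at_left x \<le> at x within S \<Longrightarrow> q \<le> d"
proof -
  obtain \<phi> \<phi>' where "C1_on S \<phi> \<phi>'" "\<phi>' x = q"
    and ev: "\<forall>\<^sub>F y in at x within S. \<psi> y - \<phi> y \<le> \<psi> x - \<phi> x"
    using assms(1) by (auto simp: slope_above_def)
  then have "(\<phi> has_real_derivative q) (at x within S)" using assms(3) by (auto simp: C1_on_def)
  then have D: "((\<lambda>y. \<phi> y - \<psi> y) has_real_derivative (q - d)) (at x within S)"
    using assms(2) by (rule DERIV_diff)
  have ev': "\<forall>\<^sub>F y in at x within S. \<phi> x - \<psi> x \<le> \<phi> y - \<psi> y"
    using ev by eventually_elim auto
  show "at_right x \<le> at x within S \<Longrightarrow> d \<le> q"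
    using derivative_nonneg_right_min[OF D _ ev'] by simp
  show "at_left x \<le> at x within S \<Longrightarrow> q \<le> d"
    using derivative_nonpos_left_min[OF D _ ev'] by simp
qed

lemma slope_above_branch_derivative:
  assumes "0 < a" "x \<in> branch a" "slope_above (branch a) \<psi> x q"
    "(\<psi> has_real_derivative d) (at x within branch a)"
  shows "q = d"
proof -
  have "at x within branch a = at x" using assms open_branch by (intro at_within_open) auto
  then show ?thesis using slope_above_derivative[OF assms(3,4,2)] 
    by (simp add: at_le antisym)
qed

lemma slope_above_end_derivative:
  assumes "0 < r" "slope_above (insert (- r) (branch (ereal r))) \<psi> (- r) q"
    "(\<psi> has_real_derivative d) (at (- r) within insert (- r) (branch (ereal r)))"
  shows "d \<le> q"
proof (rule slope_above_derivative(1)[OF assms(2,3)])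
  have "at_right (- r) = at (- r) within {- r<..<0}" 
    using assms(1) by (intro at_within_nhd[of _ "{..<0}"]) auto
  also have "\<dots> \<le> at (- r) within insert (- r) (branch (ereal r))"
    by (intro at_le) (auto simp: branch_simps)
  finally show "at_right (- r) \<le> at (- r) within insert (- r) (branch (ereal r))" .
qed auto

section \<open>Lipschitz bounds from coercivity\<close>

text \<open>This is the substitute for the mean value theorem when \<open>f\<close> is only continuous. From \<open>f\<close> one
  subtracts an increasing barrier that vanishes at \<open>x\<close>, is smaller than the gain \<open>f y - f x\<close>
  at \<open>y\<close>, and exceeds \<open>f e - f x\<close> at \<open>e\<close>; the maximum of the difference is then interior.\<close>

lemma touching_slope_of_increase:
  fixes f :: "real \<Rightarrow> real"
  assumes "continuous_on {x..e} f" "x < y" "y < e" "f x < f y"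
  shows "\<exists>\<psi> \<psi>' m. x < m \<and> m < e \<and> 0 \<le> \<psi>' m \<and> continuous_on UNIV \<psi>' \<and>
    (\<forall>t. (\<psi> has_real_derivative \<psi>' t) (at t)) \<and> (\<forall>t\<in>{x..e}. f t - \<psi> t \<le> f m - \<psi> m)"
proof -
  define \<epsilon> where "\<epsilon> = (f y - f x) / 2"
  define \<rho> where "\<rho> = (e - x) / (y - x)"
  have "\<epsilon> > 0" "\<rho> > 1" using assms by (auto simp: \<epsilon>_def \<rho>_def field_simps)
  obtain n where n: "\<bar>f e - f x\<bar> / \<epsilon> + 1 < \<rho> ^ n"
    using real_arch_pow[OF \<open>\<rho> > 1\<close>] by blast
  have "n \<noteq> 0"
  proof
    assume "n = 0"
    then have "\<bar>f e - f x\<bar> / \<epsilon> < 0" using n by simp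
    moreover have "\<bar>f e - f x\<bar> / \<epsilon> \<ge> 0" using \<open>\<epsilon> > 0\<close> by (intro divide_nonneg_pos) auto
    ultimately show False by linarith
  qed
  \<comment> \<open>The base is \<open>1\<close> at \<open>y\<close> and \<open>\<rho> > 1\<close> at \<open>e\<close>, so a high power is as steep between them as required.\<close>
  define \<psi> where "\<psi> t = \<epsilon> * ((t - x) / (y - x)) ^ n" for t
  define \<psi>' where "\<psi>' t = \<epsilon> * (real n * ((t - x) / (y - x)) ^ (n - 1) * (1 / (y - x)))" for t
  have der: "(\<psi> has_real_derivative \<psi>' t) (at t)" for t
    unfolding \<psi>_def \<psi>'_def using assms by (auto intro!: derivative_eq_intros)
  have "continuous_on {x..e} \<psi>" using der by (blast intro: DERIV_continuous_on DERIV_subset)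
  then have "continuous_on {x..e} (\<lambda>t. f t - \<psi> t)" using assms(1) by (intro continuous_intros)
  then obtain m where m: "m \<in> {x..e}" and max: "\<And>t. t \<in> {x..e} \<Longrightarrow> f t - \<psi> t \<le> f m - \<psi> m"
    using continuous_attains_sup[of "{x..e}" "\<lambda>t. f t - \<psi> t"] assms by force
  have "\<psi> x = 0" using \<open>n \<noteq> 0\<close> by (simp add: \<psi>_def)
  have "\<psi> y = \<epsilon>" using assms by (simp add: \<psi>_def)
  have "\<psi> e > \<bar>f e - f x\<bar>"
  proof -
    have "\<bar>f e - f x\<bar> < \<epsilon> * \<rho> ^ n" using n \<open>\<epsilon> > 0\<close> by (simp add: field_simps)
    then show ?thesis by (simp add: \<psi>_def \<rho>_def)
  qed
  have "f m - \<psi> m > f x" using max[of y] assms \<open>\<psi> y = \<epsilon>\<close> \<open>\<epsilon> > 0\<close> 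
    by (simp add: \<epsilon>_def field_simps)
  then have "m \<noteq> x" "m \<noteq> e" using \<open>\<psi> x = 0\<close> \<open>\<psi> e > _\<close> by auto
  then have "x < m" "m < e" using m by auto
  moreover have "0 \<le> \<psi>' m" using \<open>x < m\<close> assms \<open>\<epsilon> > 0\<close> by (auto simp: \<psi>'_def)
  moreover have "continuous_on UNIV \<psi>'" unfolding \<psi>'_def using assms by (intro continuous_intros) auto
  ultimately show ?thesis using der max by blast
qed

text \<open>If \<open>v\<close> rose faster than \<open>\<bar>R\<bar>\<close>, then \<open>v t - \<bar>R\<bar> * t\<close> would increase somewhere and be touched
  from above with a nonnegative slope, so \<open>v\<close> would have a slope of size at least \<open>\<bar>R\<bar>\<close>. Falls are treated
  by reflection. The set \<open>S\<close> on which test functions live may be larger than the interval.\<close>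

lemma lipschitz_of_slope_bound:
  assumes "l < 0" "{l<..<0} \<subseteq> S" "continuous_on {l..0} v"
    and slope: "\<And>m p. m \<in> {l<..<0} \<Longrightarrow> slope_above S v m p \<Longrightarrow> \<bar>p\<bar> < R"
  shows "x \<in> {l..0} \<Longrightarrow> y \<in> {l..0} \<Longrightarrow> \<bar>v y - v x\<bar> \<le> \<bar>R\<bar> * \<bar>y - x\<bar>"
proof -
  define C where "C = \<bar>R\<bar>"
  have no_slope: False if "m \<in> {l<..<0}" "C1_on UNIV \<psi> \<psi>'" "\<bar>\<psi>' m\<bar> \<ge> C" "e1 < m" "m < e2"
      "\<And>t. t \<in> {e1..e2} \<Longrightarrow> v t - \<psi> t \<le> v m - \<psi> m" for \<psi> \<psi>' m e1 e2
  proof -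
    have "\<forall>\<^sub>F t in at m within S. t \<in> {e1<..<e2}"
      using that(4,5) by (intro eventually_at_in_open' filter_leD[OF at_le[OF subset_UNIV]]) auto
    then have "\<forall>\<^sub>F t in at m within S. v t - \<psi> t \<le> v m - \<psi> m"
      by eventually_elim (use that(6) in auto)
    then have "slope_above S v m (\<psi>' m)"
      unfolding slope_above_def using C1_on_subset[OF that(2)] by blast
    from slope[OF that(1) this] that(3) show False by (simp add: C_def)
  qed
  have open_up: "v y - v x \<le> C * (y - x)" if "l < x" "x < y" "y < 0" for x y
  proof (rule ccontr)
    assume "\<not> ?thesis"
    then have less: "v x - C * x < v y - C * y" by (simp add: algebra_simps)
    have "continuous_on {x..0} (\<lambda>t. v t - C * t)"
      using that by (intro continuous_intros continuous_on_subset[OF assms(3)]) auto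
    from touching_slope_of_increase[OF this that(2,3) less]
    obtain \<psi> \<psi>' m where m: "x < m" "m < 0" "0 \<le> \<psi>' m" "continuous_on UNIV \<psi>'"
      and der: "\<forall>t. (\<psi> has_real_derivative \<psi>' t) (at t)"
      and max: "\<forall>t\<in>{x..0}. v t - C * t - \<psi> t \<le> v m - C * m - \<psi> m"
      by (elim exE conjE)
    have "((\<lambda>t. \<psi> t + C * t) has_real_derivative (\<psi>' t + C)) (at t)" for t
      by (auto intro!: derivative_eq_intros der[rule_format])
    then have C1: "C1_on UNIV (\<lambda>t. \<psi> t + C * t) (\<lambda>t. \<psi>' t + C)"
      using m(4) by (auto simp: C1_on_def intro!: continuous_intros)
    have max': "v t - (\<psi> t + C * t) \<le> v m - (\<psi> m + C * m)" if "t \<in> {x..0}" for t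
      using max[rule_format, OF that] by simp
    have "m \<in> {l<..<0}" using m that by simp
    moreover have "C \<le> \<bar>\<psi>' m + C\<bar>" using m(3) by (simp add: C_def)
    ultimately show False using no_slope[OF _ C1 _ m(1,2) max'] by blast
  qed
  have open_down: "v x - v y \<le> C * (y - x)" if "l < x" "x < y" "y < 0" for x y
  proof (rule ccontr)
    assume "\<not> ?thesis"
    then have less: "v (- (- y)) - C * (- y) < v (- (- x)) - C * (- x)"
      by (simp add: algebra_simps)
    have "continuous_on {-y..-l} (\<lambda>t. v (- t) - C * t)"
      using that assms(1)
      by (intro continuous_intros continuous_on_compose2[OF assms(3), of _ uminus]) auto
    from touching_slope_of_increase[OF this _ _ less] that
    obtain \<psi> \<psi>' m where m: "- y < m" "m < - l" "0 \<le> \<psi>' m" "continuous_on UNIV \<psi>'"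
      and der: "\<forall>t. (\<psi> has_real_derivative \<psi>' t) (at t)"
      and max: "\<forall>t\<in>{-y..-l}. v (- t) - C * t - \<psi> t \<le> v (- m) - C * m - \<psi> m"
      by (auto elim!: exE conjE)
    have "((\<lambda>t. \<psi> (- t) - C * t) has_real_derivative (- \<psi>' (- t) - C)) (at t)" for t
    proof -
      have "(uminus has_real_derivative - 1) (at t)" by (auto intro!: derivative_eq_intros)
      from DERIV_chain2[OF der[rule_format] this] show ?thesis
        by (auto intro!: derivative_eq_intros)
    qed
    then have C1: "C1_on UNIV (\<lambda>t. \<psi> (- t) - C * t) (\<lambda>t. - \<psi>' (- t) - C)"
      by (auto simp: C1_on_def intro!: continuous_intros continuous_on_compose2[OF m(4)])
    have max': "v t - (\<psi> (- t) - C * t) \<le> v (- m) - (\<psi> (- (- m)) - C * (- m))"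
      if "t \<in> {l..y}" for t
      using max[rule_format, of "- t"] that by simp
    have "- m \<in> {l<..<0}" "l < - m" "- m < y" using m that by simp_all
    moreover have "C \<le> \<bar>- \<psi>' (- (- m)) - C\<bar>" using m(3) by (simp add: C_def)
    ultimately show False using no_slope[OF _ C1 _ _ _ max'] by blast
  qed
  have op: "\<bar>v y - v x\<bar> \<le> C * \<bar>y - x\<bar>" if "x \<in> {l<..<0}" "y \<in> {l<..<0}" for x y
    using that open_up[of x y] open_up[of y x] open_down[of x y] open_down[of y x]
    by (cases x y rule: linorder_cases) auto
  have cl: "closure {l<..<0} = {l..0}" using assms(1) by (simp add: closure_greaterThanLessThan)
  have half: "\<bar>v y - v x\<bar> \<le> C * \<bar>y - x\<bar>" if "x \<in> {l<..<0}" "y \<in> {l..0}" for x y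
  proof -
    have "continuous_on (closure {l<..<0}) (\<lambda>y. \<bar>v y - v x\<bar> - C * \<bar>y - x\<bar>)"
      unfolding cl using assms(3) by (intro continuous_intros)
    from continuous_le_on_closure[OF this, of y 0] show ?thesis
      using op[OF that(1)] that(2) cl by simp
  qed
  show "\<bar>v y - v x\<bar> \<le> \<bar>R\<bar> * \<bar>y - x\<bar>" if "x \<in> {l..0}" "y \<in> {l..0}" for x y
  proof -
    have "continuous_on (closure {l<..<0}) (\<lambda>x. \<bar>v y - v x\<bar> - C * \<bar>y - x\<bar>)"
      unfolding cl using assms(3) by (intro continuous_intros)
    from continuous_le_on_closure[OF this, of x 0] show ?thesis
      using half[OF _ that(2)] that(1) cl by (simp add: C_def)
  qed
qed

text \<open>A common lower bound \<open>B\<close> suffices: where \<open>v\<close> has the slope \<open>p\<close> the equation gives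
  \<open>H p x \<le> - B\<close>, which by coercivity bounds \<open>p\<close> independently of \<open>v\<close>.\<close>

lemma branch_subs_equi_lipschitz:
  assumes "coercive a H" "l < 0" "{l..0} \<subseteq> cbranch a" "{l<..<0} \<subseteq> branch a"
  obtains R where "\<And>v x y. branch_sub a H b g v \<Longrightarrow> (\<And>x. x \<in> {l..0} \<Longrightarrow> B \<le> v x) \<Longrightarrow>
    x \<in> {l..0} \<Longrightarrow> y \<in> {l..0} \<Longrightarrow> \<bar>v y - v x\<bar> \<le> R * \<bar>y - x\<bar>"
proof -
  obtain R where R: "\<And>p x. R \<le> \<bar>p\<bar> \<Longrightarrow> x \<in> cbranch a \<Longrightarrow> 1 - B \<le> H p x"
    using assms(1) unfolding coercive_def by metis
  have "\<bar>v y - v x\<bar> \<le> \<bar>R\<bar> * \<bar>y - x\<bar>"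
    if sub: "branch_sub a H b g v" and low: "\<And>x. x \<in> {l..0} \<Longrightarrow> B \<le> v x"
      and xy: "x \<in> {l..0}" "y \<in> {l..0}" for v x y
  proof (rule lipschitz_of_slope_bound[OF assms(2,4) _ _ xy])
    show "continuous_on {l..0} v"
      using sub assms(3) by (auto simp: branch_sub_def intro: continuous_on_subset)
    show "\<bar>p\<bar> < R" if "m \<in> {l<..<0}" "slope_above (branch a) v m p" for m p
    proof (rule ccontr)
      assume "\<not> \<bar>p\<bar> < R"
      moreover have "m \<in> cbranch a" using that(1) by (intro subsetD[OF assms(3)]) simp
      ultimately have "1 - B \<le> H p m" by (intro R) auto
      moreover have "B \<le> v m" using low[of m] that by simp
      moreover have "v m + H p m \<le> 0" using sub that assms(4) by (auto simp: branch_sub_def)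
      ultimately show False by linarith
    qed
  qed
  then show thesis using that[of "\<bar>R\<bar>"] by blast
qed

section \<open>Perron's method on one branch\<close>

lemma continuous_on_near:
  fixes f :: "real \<Rightarrow> real"
  assumes "continuous_on S f" "x0 \<in> S" "0 < e"
  obtains d where "0 < d" "\<And>y. y \<in> S \<Longrightarrow> \<bar>y - x0\<bar> < d \<Longrightarrow> \<bar>f y - f x0\<bar> < e"
  using assms unfolding continuous_on_iff dist_real_def by blast

lemma hamiltonian_near:
  fixes H :: "real \<Rightarrow> real \<Rightarrow> real"
  assumes "continuous_on (UNIV \<times> C) (\<lambda>(p, x). H p x)" "x0 \<in> C" "0 < e"
  obtains d where "0 < d"
    "\<And>q y. y \<in> C \<Longrightarrow> \<bar>q - p\<bar> < d \<Longrightarrow> \<bar>y - x0\<bar> < d \<Longrightarrow> \<bar>H q y - H p x0\<bar> < e"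
proof -
  obtain d where d: "0 < d" and
    near: "\<And>z. z \<in> UNIV \<times> C \<Longrightarrow> dist z (p, x0) < d \<Longrightarrow>
      dist ((\<lambda>(p, x). H p x) z) ((\<lambda>(p, x). H p x) (p, x0)) < e"
    using assms unfolding continuous_on_iff by (metis SigmaI UNIV_I)
  have "\<bar>H q y - H p x0\<bar> < e" if "y \<in> C" "\<bar>q - p\<bar> < d / 2" "\<bar>y - x0\<bar> < d / 2" for q y
  proof -
    have "dist (q, y) (p, x0) \<le> \<bar>q - p\<bar> + \<bar>y - x0\<bar>"
      using sqrt_sum_squares_le_sum_abs[of "q - p" "y - x0"]
      by (simp add: dist_Pair_Pair dist_real_def)
    then have "dist (q, y) (p, x0) < d" using that by linarith
    from near[OF _ this] that show ?thesis by (simp add: dist_real_def)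
  qed
  then show thesis using that[of "d / 2"] d by simp
qed

text \<open>Stability of slopes under suprema. The test function touching \<open>w\<close> is made strict by adding
  \<open>(y - x0)\<^sup>2\<close>, with value \<open>r\<^sup>2\<close> at distance \<open>r\<close>. If \<open>v x0\<close> is within \<open>\<eta> \<le> r\<^sup>2\<close> of \<open>w x0\<close>, then
  \<open>v\<close> minus the strict test function attains its maximum over the \<open>r\<close>-ball at distance less
  than \<open>r\<close>, hence at a local maximum. When that point is \<open>x0\<close> itself, the slope is exactly \<open>p\<close>;
  this is what makes the end point conditions pass to the supremum.\<close>

lemma sup_slope_approximation:
  fixes w :: "real \<Rightarrow> real"
  assumes a: "0 < a" "x0 \<in> cbranch a"
    and cont: "\<forall>v\<in>F. continuous_on (cbranch a) v"
    and upper: "\<forall>v\<in>F. \<forall>x\<in>cbranch a. v x \<le> w x"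
    and approx: "\<forall>\<eta>>0. \<exists>v\<in>F. w x0 - \<eta> < v x0"
    and slope: "slope_above (insert x0 (branch a)) w x0 p"
    and \<epsilon>: "0 < \<epsilon>"
  obtains v y q where "v \<in> F" "y \<in> insert x0 (branch a)" "\<bar>y - x0\<bar> < \<epsilon>" "\<bar>q - p\<bar> < \<epsilon>"
    "\<bar>v y - w x0\<bar> < \<epsilon>" "slope_above (insert y (branch a)) v y q" "y = x0 \<Longrightarrow> q = p"
proof -
  define S where "S = insert x0 (branch a)"
  have Sc: "S \<subseteq> cbranch a" using a branch_subset_cbranch by (auto simp: S_def)
  obtain \<phi> \<phi>' where C1: "C1_on S \<phi> \<phi>'" "\<phi>' x0 = p"
    and ev: "\<forall>\<^sub>F y in at x0 within S. w y - \<phi> y \<le> w x0 - \<phi> x0"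
    using slope by (auto simp: slope_above_def S_def)
  obtain r0 where r0: "r0 > 0" "\<And>y. y \<in> S \<Longrightarrow> \<bar>y - x0\<bar> < r0 \<Longrightarrow> w y - \<phi> y \<le> w x0 - \<phi> x0"
    using ev unfolding eventually_at dist_real_def by (metis order_refl)
  obtain r1 where r1: "r1 > 0" "\<And>y. y \<in> cbranch a \<Longrightarrow> \<bar>y - x0\<bar> \<le> r1 \<Longrightarrow> y \<in> S"
    using cbranch_near[OF a] by (auto simp: S_def)
  have c: "continuous_on S \<phi>" "continuous_on S \<phi>'" "x0 \<in> S"
    using C1 C1_on_continuous_on by (auto simp: C1_on_def S_def)
  obtain d1 where d1: "d1 > 0" "\<And>y. y \<in> S \<Longrightarrow> \<bar>y - x0\<bar> < d1 \<Longrightarrow> \<bar>\<phi> y - \<phi> x0\<bar> < \<epsilon> / 2"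
    by (rule continuous_on_near[OF c(1,3), of "\<epsilon> / 2"]) (use \<epsilon> in auto)
  obtain d2 where d2: "d2 > 0" "\<And>y. y \<in> S \<Longrightarrow> \<bar>y - x0\<bar> < d2 \<Longrightarrow> \<bar>\<phi>' y - \<phi>' x0\<bar> < \<epsilon> / 2"
    by (rule continuous_on_near[OF c(2,3), of "\<epsilon> / 2"]) (use \<epsilon> in auto)
  define r where "r = Min {r0 / 2, r1, d1 / 2, d2 / 2, \<epsilon> / 4}"
  have rpos: "0 < r" using r0(1) r1(1) d1(1) d2(1) \<epsilon> by (simp add: r_def)
  have "r \<le> r0 / 2" "r \<le> r1" "r \<le> d1 / 2" "r \<le> d2 / 2" "r \<le> \<epsilon> / 4"
    unfolding r_def by (rule Min_le; simp)+
  then have r: "0 < r" "r < r0" "r \<le> r1" "r < d1" "r < d2" "r \<le> \<epsilon> / 4"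
    using rpos by linarith+
  define \<eta> where "\<eta> = min (r\<^sup>2) (\<epsilon> / 4)"
  have \<eta>: "0 < \<eta>" "\<eta> \<le> r\<^sup>2" "\<eta> \<le> \<epsilon> / 4" using r \<epsilon> by (auto simp: \<eta>_def)
  obtain v where v: "v \<in> F" "w x0 - \<eta> < v x0" using approx \<eta>(1) by blast
  define \<psi> where "\<psi> y = 0 + \<phi> y + 1 * (y - x0)\<^sup>2" for y
  define \<psi>' where "\<psi>' y = \<phi>' y + 2 * 1 * (y - x0)" for y
  have \<psi>: "C1_on S \<psi> \<psi>'" unfolding \<psi>_def \<psi>'_def by (rule C1_on_add_square[OF C1(1)])
  have \<psi>'_eq: "\<psi>' y = \<phi>' y + 2 * (y - x0)" for y by (simp add: \<psi>'_def)
  define K where "K = cbranch a \<inter> cball x0 r"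
  have K: "y \<in> K \<longleftrightarrow> y \<in> S \<and> \<bar>y - x0\<bar> \<le> r" for y
    using r1 r Sc by (auto simp: K_def dist_real_def abs_minus_commute)
  have "compact K" using closed_cbranch[OF a(1)] by (auto simp: K_def closed_Int_compact)
  moreover have "continuous_on K (\<lambda>y. v y - \<psi> y)"
    using K Sc by (intro continuous_intros continuous_on_subset[OF cont[rule_format, OF v(1)]]
        continuous_on_subset[OF C1_on_continuous_on[OF \<psi>]]) auto
  moreover have "x0 \<in> K" using K c(3) r by auto
  ultimately have "\<exists>y\<in>K. \<forall>t\<in>K. v t - \<psi> t \<le> v y - \<psi> y"
    by (intro continuous_attains_sup) auto
  then obtain y where y: "y \<in> K" and max: "\<And>t. t \<in> K \<Longrightarrow> v t - \<psi> t \<le> v y - \<psi> y" by blast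
  have yS: "y \<in> S" "\<bar>y - x0\<bar> \<le> r" using K y by auto
  have low: "w x0 - \<eta> - \<phi> x0 < v y - \<phi> y - (y - x0)\<^sup>2"
    using max[OF \<open>x0 \<in> K\<close>] v(2) by (simp add: \<psi>_def)
  have up: "v y \<le> w x0 - \<phi> x0 + \<phi> y"
    using upper[rule_format, OF v(1), of y] r0(2)[of y] yS r Sc by force
  from low up have sq: "(y - x0)\<^sup>2 < \<eta>" by linarith
  then have yr: "\<bar>y - x0\<bar> < r" using \<eta>(2) r(1) abs_le_square_iff[of r "y - x0"] by simp
  have \<phi>y: "\<bar>\<phi> y - \<phi> x0\<bar> < \<epsilon> / 2" "\<bar>\<phi>' y - \<phi>' x0\<bar> < \<epsilon> / 2" using d1 d2 yS r by auto
  define T where "T = insert y (branch a)"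
  have TS: "T \<subseteq> S" using yS by (auto simp: T_def S_def)
  have "\<forall>\<^sub>F t in at y within T. v t - \<psi> t \<le> v y - \<psi> y"
    unfolding eventually_at dist_real_def
  proof (intro exI conjI ballI impI)
    show "0 < r - \<bar>y - x0\<bar>" using yr by simp
    fix t assume "t \<in> T" "t \<noteq> y \<and> \<bar>t - y\<bar> < r - \<bar>y - x0\<bar>"
    then have "t \<in> K" using K TS by auto
    then show "v t - \<psi> t \<le> v y - \<psi> y" by (rule max)
  qed
  then have "slope_above T v y (\<psi>' y)"
    unfolding slope_above_def using C1_on_subset[OF \<psi> TS] by blast
  moreover have "\<bar>\<psi>' y - p\<bar> < \<epsilon>" using \<phi>y(2) yr r(6) unfolding \<psi>'_eq C1(2) by argo
  moreover have "\<bar>v y - w x0\<bar> < \<epsilon>"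
    using low up sq \<phi>y(1) \<eta>(3) zero_le_power2[of "y - x0"] by linarith
  moreover have "\<bar>y - x0\<bar> < \<epsilon>" using yr r(6) \<epsilon> by linarith
  moreover have "y = x0 \<Longrightarrow> \<psi>' y = p" using C1(2) by (simp add: \<psi>'_def)
  ultimately show thesis using that v(1) yS unfolding S_def T_def by blast
qed

text \<open>Near \<open>x0\<close>, where \<open>w\<close> violates the super-solution property with room to spare, \<open>w\<close> is replaced by
  its maximum with the test function lowered by \<open>(y - x0)\<^sup>2\<close> and raised by \<open>\<delta> < r\<^sup>2\<close>. At distance
  \<open>r\<close> the maximum is \<open>w\<close> again, so the change is local, and where it is active the sub-solution
  inequality holds by continuity of the Hamiltonian. The hypothesis \<open>end_neg\<close> says that the boundary alternative
  fails too when \<open>x0\<close> is the outer end point.\<close>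

lemma bump_subsolution:
  fixes w :: "real \<Rightarrow> real"
  assumes a: "0 < a" "x0 \<in> cbranch a"
    and H: "continuous_on (UNIV \<times> cbranch a) (\<lambda>(p, x). H p x)"
    and sub: "branch_sub a H b g w"
    and slope: "slope_below (insert x0 (branch a)) w x0 p"
    and neg: "w x0 + H p x0 < 0"
    and end_neg: "\<forall>s. a = ereal s \<and> x0 = - s \<longrightarrow>
      (case b of Dirichlet d \<Rightarrow> w x0 < d | Neumann h \<Rightarrow> - p < h | State_Constraint \<Rightarrow> True)"
    and \<epsilon>: "0 < \<epsilon>"
  obtains v where "branch_sub a H b g v" "\<And>x. w x \<le> v x" "w x0 < v x0" "v x0 \<le> w x0 + \<epsilon>"
    "x0 \<noteq> 0 \<Longrightarrow> v 0 = w 0"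
proof -
  define S where "S = insert x0 (branch a)"
  have Sc: "S \<subseteq> cbranch a" using a branch_subset_cbranch by (auto simp: S_def)
  have wc: "continuous_on (cbranch a) w" using sub by (simp add: branch_sub_def)
  obtain \<phi> \<phi>' where C1: "C1_on S \<phi> \<phi>'" "\<phi>' x0 = p"
    and ev: "\<forall>\<^sub>F y in at x0 within S. w y - \<phi> y \<ge> w x0 - \<phi> x0"
    using slope by (auto simp: slope_below_def S_def)
  obtain r0 where r0: "r0 > 0" "\<And>y. y \<in> S \<Longrightarrow> \<bar>y - x0\<bar> < r0 \<Longrightarrow> w y - \<phi> y \<ge> w x0 - \<phi> x0"
    using ev unfolding eventually_at dist_real_def by (metis order_refl)
  obtain r1 where r1: "r1 > 0" "\<And>y. y \<in> cbranch a \<Longrightarrow> \<bar>y - x0\<bar> \<le> r1 \<Longrightarrow> y \<in> S"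
    using cbranch_near[OF a] by (auto simp: S_def)
  define e where "e = - (w x0 + H p x0) / 2"
  have e: "e > 0" using neg by (simp add: e_def)
  obtain \<rho> where \<rho>: "\<rho> > 0"
    "\<And>q y. y \<in> cbranch a \<Longrightarrow> \<bar>q - p\<bar> < \<rho> \<Longrightarrow> \<bar>y - x0\<bar> < \<rho> \<Longrightarrow> \<bar>H q y - H p x0\<bar> < e"
    using hamiltonian_near[OF H a(2) e] by blast
  have c: "continuous_on S \<phi>" "continuous_on S \<phi>'" "x0 \<in> S"
    using C1 C1_on_continuous_on by (auto simp: C1_on_def S_def)
  obtain d1 where d1: "d1 > 0" "\<And>y. y \<in> S \<Longrightarrow> \<bar>y - x0\<bar> < d1 \<Longrightarrow> \<bar>\<phi> y - \<phi> x0\<bar> < e / 2"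
    by (rule continuous_on_near[OF c(1,3), of "e / 2"]) (use e in auto)
  obtain d2 where d2: "d2 > 0" "\<And>y. y \<in> S \<Longrightarrow> \<bar>y - x0\<bar> < d2 \<Longrightarrow> \<bar>\<phi>' y - \<phi>' x0\<bar> < \<rho> / 2"
    by (rule continuous_on_near[OF c(2,3), of "\<rho> / 2"]) (use \<rho>(1) in auto)
  define r where "r = Min {r0 / 2, r1, d1 / 2, d2 / 2, \<rho> / 4, e / 8, 1}"
  have rpos: "0 < r" using r0(1) r1(1) d1(1) d2(1) \<rho>(1) e by (simp add: r_def)
  have "r \<le> r0 / 2" "r \<le> r1" "r \<le> d1 / 2" "r \<le> d2 / 2" "r \<le> \<rho> / 4" "r \<le> e / 8" "r \<le> 1"
    unfolding r_def by (rule Min_le; simp)+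
  then have r: "0 < r" "r < r0" "r \<le> r1" "r < d1" "r < d2" "r \<le> \<rho> / 4" "r \<le> e / 8" "r \<le> 1"
    using rpos by linarith+
  have r2: "0 < r\<^sup>2" "r\<^sup>2 \<le> e / 8"
    using r(1,7,8) mult_left_mono[of r 1 r] unfolding power2_eq_square by (simp, linarith)
  \<comment> \<open>Below a Dirichlet datum \<open>d\<close> the raised value at the end point must stay below \<open>d\<close>.\<close>
  define \<delta>0 where "\<delta>0 = (case b of Dirichlet d \<Rightarrow> if w x0 < d then d - w x0 else 1 | _ \<Rightarrow> 1)"
  define \<delta> where "\<delta> = Min {r\<^sup>2 / 2, \<epsilon>, \<delta>0}"
  have "\<delta>0 > 0" by (auto simp: \<delta>0_def split: end_cond.split)
  then have \<delta>: "0 < \<delta>" "\<delta> < r\<^sup>2" "\<delta> \<le> \<epsilon>" "\<delta> \<le> \<delta>0"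
    using r2 \<epsilon> by (auto simp: \<delta>_def min_less_iff_disj)
  define \<psi> where "\<psi> y = (w x0 - \<phi> x0 + \<delta>) + \<phi> y + (-1) * (y - x0)\<^sup>2" for y
  define \<psi>' where "\<psi>' y = \<phi>' y + 2 * (-1) * (y - x0)" for y
  have \<psi>: "C1_on S \<psi> \<psi>'" unfolding \<psi>_def \<psi>'_def by (rule C1_on_add_square[OF C1(1)])
  have \<psi>_eq: "\<psi> y = w x0 - \<phi> x0 + \<delta> + \<phi> y - (y - x0)\<^sup>2"
    and \<psi>'_eq: "\<psi>' y = \<phi>' y - 2 * (y - x0)" for y
    by (simp_all add: \<psi>_def \<psi>'_def)
  define v where "v y = (if \<bar>y - x0\<bar> \<le> r then max (w y) (\<psi> y) else w y)" for y
  have wv: "w y \<le> v y" for y by (simp add: v_def)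
  have sphere: "\<psi> y < w y" if "y \<in> cbranch a" "\<bar>y - x0\<bar> = r" for y
  proof -
    have "(y - x0)\<^sup>2 = r\<^sup>2" using that(2) by (metis power2_abs)
    then show ?thesis using r0(2)[of y] r1(2)[of y] that r \<delta>(2) by (simp add: \<psi>_def)
  qed
  have lifted: "y \<in> S \<and> \<bar>y - x0\<bar> < r \<and> v y = \<psi> y \<and> \<psi> y + H (\<psi>' y) y < 0"
    if "y \<in> cbranch a" "v y \<noteq> w y" for y
  proof -
    have y: "\<bar>y - x0\<bar> \<le> r" "v y = \<psi> y" "w y < \<psi> y"
      using that(2) by (auto simp: v_def max_def split: if_splits)
    then have "\<bar>y - x0\<bar> < r" using sphere[OF that(1)] by force
    have yS: "y \<in> S" using r1(2)[OF that(1)] y r by simp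
    have sq: "(y - x0)\<^sup>2 \<le> r\<^sup>2" using y(1) r(1) abs_le_square_iff[of "y - x0" r] by simp
    have "\<bar>\<phi> y - \<phi> x0\<bar> < e / 2" "\<bar>\<phi>' y - \<phi>' x0\<bar> < \<rho> / 2" using d1 d2 yS y(1) r by auto
    then have "\<psi> y < w x0 + e" "\<bar>y - x0\<bar> < \<rho>" and "\<bar>\<psi>' y - p\<bar> < \<rho>"
      using sq r2 \<delta>(2) y(1) r(1,6) e zero_le_power2[of "y - x0"]
      unfolding \<psi>_eq \<psi>'_eq C1(2) by (linarith, linarith, argo)
    moreover from this have "\<bar>H (\<psi>' y) y - H p x0\<bar> < e" using \<rho>(2) that(1) by blast
    ultimately have "\<psi> y + H (\<psi>' y) y < 0" unfolding e_def by argo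
    then show ?thesis using yS y \<open>\<bar>y - x0\<bar> < r\<close> by blast
  qed
  have touch: "(v y = w y \<and> slope_above T w y q) \<or> (v y \<noteq> w y \<and> slope_above T \<psi> y q)"
    if "y \<in> cbranch a" "slope_above T v y q" for T y q
  proof (cases "v y = w y")
    case True
    then show ?thesis using slope_above_mono[OF that(2), of w] wv by simp
  next
    case False
    note y = lifted[OF that(1) False]
    have "\<forall>\<^sub>F t in at y within T. \<psi> t \<le> v t"
      unfolding eventually_at dist_real_def
    proof (intro exI conjI ballI impI)
      show "0 < r - \<bar>y - x0\<bar>" using y by simp
      fix t assume "t \<in> T" "t \<noteq> y \<and> \<bar>t - y\<bar> < r - \<bar>y - x0\<bar>"
      then have "\<bar>t - x0\<bar> \<le> r" using abs_triangle_ineq[of "t - y" "y - x0"] by simp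
      then show "\<psi> t \<le> v t" by (simp add: v_def)
    qed
    then show ?thesis using slope_above_mono[OF that(2), of \<psi>] y False by simp
  qed
  have "continuous_on (cbranch a) v"
    unfolding v_def
  proof (rule continuous_on_cases_le)
    have "{t \<in> cbranch a. \<bar>t - x0\<bar> \<le> r} \<subseteq> S" using r1(2) r(3) by auto
    then show "continuous_on {t \<in> cbranch a. \<bar>t - x0\<bar> \<le> r} (\<lambda>t. max (w t) (\<psi> t))"
      by (intro continuous_intros continuous_on_subset[OF wc]
          continuous_on_subset[OF C1_on_continuous_on[OF \<psi>]]) auto
    show "continuous_on {t \<in> cbranch a. r \<le> \<bar>t - x0\<bar>} w"
      by (intro continuous_on_subset[OF wc]) auto
    show "continuous_on (cbranch a) (\<lambda>t. \<bar>t - x0\<bar>)" by (intro continuous_intros)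
    show "\<And>t. t \<in> cbranch a \<Longrightarrow> \<bar>t - x0\<bar> = r \<Longrightarrow> max (w t) (\<psi> t) = w t"
      using sphere by (intro max_absorb1) (simp add: less_imp_le)
  qed
  moreover have "v y + H q y \<le> 0" if "y \<in> branch a" "slope_above (branch a) v y q" for y q
  proof -
    have yc: "y \<in> cbranch a" using that branch_subset_cbranch by auto
    from touch[OF this that(2)] show ?thesis
    proof (elim disjE conjE)
      assume "v y = w y" "slope_above (branch a) w y q"
      then show ?thesis using sub that(1) by (auto simp: branch_sub_def)
    next
      assume *: "v y \<noteq> w y" "slope_above (branch a) \<psi> y q"
      have "C1_on (branch a) \<psi> \<psi>'" by (rule C1_on_subset[OF \<psi>]) (auto simp: S_def)
      then have "q = \<psi>' y"
        using slope_above_branch_derivative[OF a(1) that(1) *(2)] that(1)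
        by (auto simp: C1_on_def)
      then show ?thesis using lifted[OF yc *(1)] by simp
    qed
  qed
  moreover have "end_sub a H b g v"
    using a(1)
  proof (cases rule: pos_ereal_cases)
    case (finite s)
    define z where "z = - s"
    define T where "T = insert z (branch a)"
    have zc: "z \<in> cbranch a" "z \<notin> branch a" using finite by (auto simp: z_def branch_simps)
    have "case b of Dirichlet d \<Rightarrow> v z \<le> d \<or> v z + H q z \<le> 0
        | Neumann h \<Rightarrow> - q \<le> h \<or> v z + H q z \<le> 0 | State_Constraint \<Rightarrow> True"
      if q: "slope_above T v z q" for q
      using touch[OF zc(1) q]
    proof (elim disjE conjE)
      assume "v z = w z" "slope_above T w z q"
      then show ?thesis
        using sub finite by (auto simp: branch_sub_def end_sub_def Let_def T_def z_def
            split: end_cond.splits)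
    next
      assume *: "v z \<noteq> w z" "slope_above T \<psi> z q"
      note z = lifted[OF zc(1) *(1)]
      then have zx: "z = x0" using zc by (auto simp: S_def)
      then have "(\<psi> has_real_derivative \<psi>' z) (at z within T)"
        using \<psi> by (auto simp: C1_on_def T_def S_def)
      then have "\<psi>' z \<le> q"
        using slope_above_end_derivative[of s \<psi> q "\<psi>' z"] *(2) finite by (simp add: T_def z_def)
      then have "p \<le> q" using C1(2) zx by (simp add: \<psi>'_def)
      moreover have "v z = w x0 + \<delta>" using z zx by (simp add: \<psi>_def)
      moreover have "case b of Dirichlet d \<Rightarrow> w x0 < d | Neumann h \<Rightarrow> - p < h | State_Constraint \<Rightarrow> True"
        using end_neg finite(1) zx z_def by blast
      ultimately show ?thesis
        using \<delta>(4) by (auto simp: \<delta>0_def split: end_cond.splits)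
    qed
    then show ?thesis using finite by (simp add: end_sub_def T_def z_def[symmetric] Let_def)
  next
    case infinite
    have "\<forall>\<^sub>F y in at_bot. v y = w y"
      using eventually_le_at_bot[of "x0 - r - 1"] by eventually_elim (auto simp: v_def)
    then show ?thesis
      using sub infinite landau_o.big.in_cong[of v w at_bot "\<lambda>x. 1 + \<bar>g x\<bar>"]
      by (simp add: branch_sub_def end_sub_def)
  qed
  ultimately have "branch_sub a H b g v" by (simp add: branch_sub_def)
  moreover have "v x0 = w x0 + \<delta>" using r(1) \<delta>(1) by (simp add: v_def \<psi>_def)
  moreover have "v 0 = w 0" if "x0 \<noteq> 0"
  proof -
    have "0 \<notin> S" using that zero_notin_branch by (simp add: S_def)
    then show ?thesis using lifted[OF zero_in_cbranch[OF a(1)]] by blast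
  qed
  ultimately show thesis using that wv \<delta>(1,3) by simp
qed


text \<open>The lower bound \<open>v0\<close> makes the family equi-Lipschitz locally, the state-constraint
  super-solution \<open>U\<close> bounds it from above, and on an unbounded branch the two together control the
  growth of the supremum. Raising the supremum inside the family is excluded by maximality; at
  \<open>0\<close> the bound \<open>c\<close> may prevent raising, which is why the state-constraint property holds only
  if \<open>w 0 < c\<close>.\<close>

lemma perron_solution:
  assumes a: "0 < a"
    and H: "continuous_on (UNIV \<times> cbranch a) (\<lambda>(p, x). H p x)"
    and coer: "coercive a H"
    and comp: "branch_comparison a H b g"
    and v0: "branch_sub a H b g v0" "v0 0 \<le> c"
    and U: "branch_sc_super a H b g U"
  obtains w where "branch_sub a H b g w" "branch_super a H b g w"
    "\<And>x. x \<in> cbranch a \<Longrightarrow> v0 x \<le> w x" "w 0 \<le> c" "w 0 < c \<Longrightarrow> branch_sc_super a H b g w"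
proof -
  define F where "F = {v. branch_sub a H b g v \<and> v 0 \<le> c \<and> (\<forall>x\<in>cbranch a. v0 x \<le> v x)}"
  define w where "w x = (SUP v\<in>F. v x)" for x
  have v0F: "v0 \<in> F" using v0 by (simp add: F_def)
  have below_U: "v x \<le> U x" if "v \<in> F" "x \<in> cbranch a" for v x
    using comp U that unfolding branch_comparison_def F_def branch_sc_super_def by blast
  have bdd: "bdd_above ((\<lambda>v. v x) ` F)" if "x \<in> cbranch a" for x
    using below_U that by (intro bdd_aboveI2[where M = "U x"]) auto
  have upper: "v x \<le> w x" if "v \<in> F" "x \<in> cbranch a" for v x
    unfolding w_def using that bdd by (intro cSUP_upper) auto
  have least: "w x \<le> k" if "\<And>v. v \<in> F \<Longrightarrow> v x \<le> k" for x k
    unfolding w_def using that v0F by (intro cSUP_least) auto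
  have approx: "\<exists>v\<in>F. w x - \<eta> < v x" if "0 < \<eta>" for x \<eta>
    using least[of x "w x - \<eta>"] that by force
  have v0_w: "v0 x \<le> w x" if "x \<in> cbranch a" for x using upper[OF v0F that] .
  have w0c: "w 0 \<le> c" using least[of 0 c] by (simp add: F_def)
  have cont: "continuous_on (cbranch a) w"
    unfolding continuous_on_iff
  proof (intro ballI allI impI)
    fix x e :: real assume x: "x \<in> cbranch a" and e: "0 < e"
    obtain l r where l: "l < 0" "0 < r" "{l..0} \<subseteq> cbranch a" "{l<..<0} \<subseteq> branch a"
      and lr: "\<And>y. y \<in> cbranch a \<Longrightarrow> \<bar>y - x\<bar> < r \<Longrightarrow> l \<le> y"
      using cbranch_left_interval[OF a x] by metis
    have "continuous_on {l..0} v0"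
      using v0 l(3) by (auto simp: branch_sub_def intro: continuous_on_subset)
    then obtain B where B: "\<And>y. y \<in> {l..0} \<Longrightarrow> B \<le> v0 y"
      using continuous_attains_inf[of "{l..0}" v0] l(1) by force
    obtain R where R: "\<And>v x y. branch_sub a H b g v \<Longrightarrow> (\<And>x. x \<in> {l..0} \<Longrightarrow> B \<le> v x) \<Longrightarrow>
        x \<in> {l..0} \<Longrightarrow> y \<in> {l..0} \<Longrightarrow> \<bar>v y - v x\<bar> \<le> R * \<bar>y - x\<bar>"
      using branch_subs_equi_lipschitz[OF coer l(1,3,4)] by metis
    have FR: "\<bar>v y - v z\<bar> \<le> R * \<bar>y - z\<bar>" if "v \<in> F" "y \<in> {l..0}" "z \<in> {l..0}" for v y z
    proof (rule R)
      show "branch_sub a H b g v" using that by (simp add: F_def)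
      show "B \<le> v t" if "t \<in> {l..0}" for t
        using B[OF that] \<open>v \<in> F\<close> that l(3) by (force simp: F_def)
    qed (use that in auto)
    have one: "w y \<le> w z + R * \<bar>y - z\<bar>" if "y \<in> {l..0}" "z \<in> {l..0}" for y z
    proof (rule least)
      fix v assume v: "v \<in> F"
      have "z \<in> cbranch a" using that(2) l(3) by blast
      from upper[OF v this] FR[OF v that] show "v y \<le> w z + R * \<bar>y - z\<bar>" by linarith
    qed
    define d where "d = min r (e / (\<bar>R\<bar> + 1))"
    have "d > 0" using l(2) e by (auto simp: d_def)
    moreover have "dist (w y) (w x) < e" if y: "y \<in> cbranch a" "dist y x < d" for y
    proof -
      have "y \<le> 0" "x \<le> 0" using x y by (auto simp: cbranch_def)
      then have yl: "y \<in> {l..0}" "x \<in> {l..0}"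
        using lr[of y] lr[of x] x y l(2) by (auto simp: d_def dist_real_def)
      have "\<bar>w y - w x\<bar> \<le> R * \<bar>y - x\<bar>"
        using one[OF yl] one[OF yl(2,1)] by (simp add: abs_minus_commute abs_le_iff)
      also have "\<dots> \<le> (\<bar>R\<bar> + 1) * \<bar>y - x\<bar>" by (intro mult_right_mono) auto
      also have "\<dots> < e" using y(2) by (simp add: d_def dist_real_def field_simps)
      finally show ?thesis by (simp add: dist_real_def)
    qed
    ultimately show "\<exists>d>0. \<forall>y\<in>cbranch a. dist y x < d \<longrightarrow> dist (w y) (w x) < e" by blast
  qed
  have F_cont: "continuous_on (cbranch a) v" if "v \<in> F" for v
    using that by (simp add: F_def branch_sub_def)
  \<comment> \<open>If \<open>w\<close> violates the equation at \<open>x\<close>, so do members of the family at nearby points; it remains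
    to exclude this from their own sub-solution property, in the interior and at the end point.\<close>
  have no_approximants: False
    if x: "x \<in> cbranch a" and slope: "slope_above (insert x (branch a)) w x p"
      and pos: "0 < w x + H p x"
      and none: "\<And>v y q. v \<in> F \<Longrightarrow> slope_above (insert y (branch a)) v y q \<Longrightarrow>
        0 < v y + H q y \<Longrightarrow> y \<in> insert x (branch a) \<Longrightarrow> (y = x \<Longrightarrow> q = p) \<Longrightarrow>
        \<bar>v y - w x\<bar> < \<epsilon> \<Longrightarrow> False"
      and "0 < \<epsilon>" for x p \<epsilon>
  proof -
    define e where "e = (w x + H p x) / 2"
    have e: "0 < e" using pos by (simp add: e_def)
    obtain d where d: "0 < d"
      "\<And>q y. y \<in> cbranch a \<Longrightarrow> \<bar>q - p\<bar> < d \<Longrightarrow> \<bar>y - x\<bar> < d \<Longrightarrow> \<bar>H q y - H p x\<bar> < e"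
      using hamiltonian_near[OF H x e] by blast
    have F_props: "\<forall>v\<in>F. continuous_on (cbranch a) v"
      "\<forall>v\<in>F. \<forall>y\<in>cbranch a. v y \<le> w y" "\<forall>\<eta>>0. \<exists>v\<in>F. w x - \<eta> < v x"
      using F_cont upper approx by blast+
    have "0 < min \<epsilon> (min d e)" using d(1) e \<open>0 < \<epsilon>\<close> by simp
    then obtain v y q where v: "v \<in> F" and y: "y \<in> insert x (branch a)" "\<bar>y - x\<bar> < min \<epsilon> (min d e)"
      "\<bar>q - p\<bar> < min \<epsilon> (min d e)" "\<bar>v y - w x\<bar> < min \<epsilon> (min d e)"
      "slope_above (insert y (branch a)) v y q" "y = x \<Longrightarrow> q = p"
      using sup_slope_approximation[OF a x F_props slope]
      by metis
    have "y \<in> cbranch a" using y(1) x branch_subset_cbranch by auto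
    then have "\<bar>H q y - H p x\<bar> < e" using d(2) y by simp
    then have "0 < v y + H q y" using y(4) unfolding e_def by argo
    then show False using none[OF v y(5) _ y(1,6)] y(4) by simp
  qed
  have w_sub: "branch_sub a H b g w"
    unfolding branch_sub_def
  proof (intro conjI ballI allI impI cont)
    fix x p assume x: "x \<in> branch a" and p: "slope_above (branch a) w x p"
    show "w x + H p x \<le> 0"
    proof (rule ccontr)
      assume "\<not> ?thesis"
      then have pos: "0 < w x + H p x" by simp
      have "insert y (branch a) = branch a" if "y \<in> insert x (branch a)" for y
        using that x by auto
      then show False
        using no_approximants[of x p 1] x p pos branch_subset_cbranch
        by (force simp: F_def branch_sub_def)
    qed
  next
    show "end_sub a H b g w"
      using a
    proof (cases rule: pos_ereal_cases)
      case (finite s)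
      define z where "z = - s"
      have z: "z \<in> cbranch a" using finite by (auto simp: z_def branch_simps)
      have "case b of Dirichlet d \<Rightarrow> w z \<le> d \<or> w z + H p z \<le> 0
        | Neumann h \<Rightarrow> - p \<le> h \<or> w z + H p z \<le> 0 | State_Constraint \<Rightarrow> True"
        if p: "slope_above (insert z (branch a)) w z p" for p
      proof (rule ccontr)
        assume neg: "\<not> ?thesis"
        \<comment> \<open>Close enough that \<open>v z\<close> inherits \<open>w z > d\<close> from a violated Dirichlet alternative.\<close>
        define \<epsilon> where "\<epsilon> = (case b of Dirichlet d \<Rightarrow> w z - d | _ \<Rightarrow> 1)"
        have "0 < \<epsilon>" using neg by (auto simp: \<epsilon>_def split: end_cond.splits)
        have pos: "0 < w z + H p z" using neg by (auto split: end_cond.splits)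
        show False
        proof (rule no_approximants[OF z p pos _ \<open>0 < \<epsilon>\<close>])
          fix v y q
          assume v: "v \<in> F" and q: "slope_above (insert y (branch a)) v y q"
            and vp: "0 < v y + H q y" and y: "y \<in> insert z (branch a)"
            and qp: "y = z \<Longrightarrow> q = p" and ve: "\<bar>v y - w z\<bar> < \<epsilon>"
          have sub: "branch_sub a H b g v" using v by (simp add: F_def)
          show False
          proof (cases "y \<in> branch a")
            case True
            then show False using sub q vp by (force simp: branch_sub_def insert_absorb)
          next
            case False
            then have "y = z" using y by simp
            then show False
              using sub q vp qp ve neg finite
              by (auto simp: branch_sub_def end_sub_def Let_def z_def \<epsilon>_def
                  split: end_cond.splits)
          qed
        qed
      qed
      then show ?thesis using finite by (simp add: end_sub_def Let_def z_def[symmetric])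
    next
      case infinite
      have "\<forall>\<^sub>F x in at_bot. norm (w x) \<le> 1 * norm (\<bar>v0 x\<bar> + \<bar>U x\<bar>)"
        using eventually_le_at_bot[of 0]
      proof eventually_elim
        case (elim x)
        then have x: "x \<in> cbranch a" using infinite by (simp add: branch_simps)
        from v0_w[OF x] least[of x "U x"] below_U[OF _ x] show ?case by force
      qed
      then have "w \<in> O[at_bot](\<lambda>x. \<bar>v0 x\<bar> + \<bar>U x\<bar>)" by (rule bigoI)
      also have "(\<lambda>x. \<bar>v0 x\<bar> + \<bar>U x\<bar>) \<in> O[at_bot](\<lambda>x. 1 + \<bar>g x\<bar>)"
        using v0(1) U infinite
        by (intro sum_in_bigo)
          (auto simp: branch_sub_def end_sub_def branch_sc_super_def branch_super_def end_super_def)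
      finally show ?thesis using infinite by (simp add: end_sub_def)
    qed
  qed
  have super: "0 \<le> w x + H p x"
    if x: "x \<in> cbranch a" and slope: "slope_below (insert x (branch a)) w x p"
      and end_neg: "\<forall>s. a = ereal s \<and> x = - s \<longrightarrow>
        (case b of Dirichlet d \<Rightarrow> w x < d | Neumann h \<Rightarrow> - p < h | State_Constraint \<Rightarrow> True)"
      and zero: "x = 0 \<Longrightarrow> w 0 < c" for x p
  proof (rule ccontr)
    assume "\<not> ?thesis"
    then have neg: "w x + H p x < 0" by simp
    define \<epsilon> where "\<epsilon> = (if w 0 < c then c - w 0 else 1)"
    have \<epsilon>: "0 < \<epsilon>" by (simp add: \<epsilon>_def)
    obtain v where v: "branch_sub a H b g v" "\<And>y. w y \<le> v y" "w x < v x" "v x \<le> w x + \<epsilon>"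
      "x \<noteq> 0 \<Longrightarrow> v 0 = w 0"
      using bump_subsolution[OF a x H w_sub slope neg end_neg \<epsilon>] by metis
    have "v 0 \<le> c" using v(4,5) zero w0c by (cases "x = 0") (auto simp: \<epsilon>_def)
    moreover have "\<forall>y\<in>cbranch a. v0 y \<le> v y" using v0_w v(2) by (blast intro: order_trans)
    ultimately have "v \<in> F" using v(1) by (simp add: F_def)
    then show False using upper[OF _ x] v(3) by force
  qed
  have w_super: "branch_super a H b g w"
    unfolding branch_super_def
  proof (intro conjI ballI allI impI cont)
    fix x p assume x: "x \<in> branch a" and p: "slope_below (branch a) w x p"
    have "x \<noteq> - s" if "a = ereal s" for s using x that by (auto simp: branch_simps)
    moreover have "x \<noteq> 0" using x zero_notin_branch by blast
    ultimately show "w x + H p x \<ge> 0"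
      using super[of x p] x p branch_subset_cbranch by (auto simp: insert_absorb)
  next
    show "end_super a H b g w"
      using a
    proof (cases rule: pos_ereal_cases)
      case (finite s)
      define z where "z = - s"
      have z: "z \<in> cbranch a" "z \<noteq> 0" using finite by (auto simp: z_def branch_simps)
      have "case b of Dirichlet d \<Rightarrow> w z \<ge> d \<or> w z + H p z \<ge> 0
        | Neumann h \<Rightarrow> - p \<ge> h \<or> w z + H p z \<ge> 0 | State_Constraint \<Rightarrow> w z + H p z \<ge> 0"
        if p: "slope_below (insert z (branch a)) w z p" for p
      proof (cases "w z + H p z \<ge> 0")
        case True
        then show ?thesis by (simp split: end_cond.split)
      next
        case False
        then have "\<not> (case b of Dirichlet d \<Rightarrow> w z < d | Neumann h \<Rightarrow> - p < h | State_Constraint \<Rightarrow> True)"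
          using super[OF z(1) p] z(2) by blast
        then show ?thesis by (auto split: end_cond.splits)
      qed
      then show ?thesis using finite by (simp add: end_super_def Let_def z_def[symmetric])
    next
      case infinite
      then show ?thesis using w_sub by (simp add: branch_sub_def end_sub_def end_super_def)
    qed
  qed
  have "branch_sc_super a H b g w" if "w 0 < c"
    unfolding branch_sc_super_def
  proof (intro conjI allI impI w_super)
    fix p assume p: "slope_below (insert 0 (branch a)) w 0 p"
    have "0 \<noteq> - s" if "a = ereal s" for s using a that by auto
    then show "w 0 + H p 0 \<ge> 0"
      using super[OF zero_in_cbranch[OF a] p] \<open>w 0 < c\<close> by blast
  qed
  then show thesis using that w_sub w_super v0_w w0c by blast
qed

text \<open>On a bounded branch a coercive Hamiltonian is bounded below, so a large constant is a
  state-constraint super-solution. An affine function that is low enough is a sub-solution; its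
  slope is chosen steep enough for the Neumann condition. Perron's method is run with a value bound
  above that of the constant super-solution, so that the bound is inactive at the junction.\<close>

lemma branch_sc_solution_exists:
  assumes a: "0 < a" "a \<noteq> \<infinity>"
    and H: "continuous_on (UNIV \<times> cbranch a) (\<lambda>(p, x). H p x)"
    and coer: "coercive a H"
    and comp: "branch_comparison a H b g"
  shows "\<exists>w. branch_sc_solution a H b g w"
proof -
  obtain r where r: "a = ereal r" "0 < r" using a by (cases a) auto
  define z where "z = - r"
  have ca: "cbranch a = {z..0}" "branch a = {z<..<0}" "z < 0"
    using r by (auto simp: branch_simps z_def)
  obtain R where R: "\<And>p x. R \<le> \<bar>p\<bar> \<Longrightarrow> x \<in> cbranch a \<Longrightarrow> 0 \<le> H p x"
    using coer unfolding coercive_def by metis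
  define Q where "Q = {-\<bar>R\<bar>..\<bar>R\<bar>} \<times> {z..0}"
  have "compact Q" by (auto simp: Q_def intro: compact_Times)
  moreover have "continuous_on Q (\<lambda>(p, x). H p x)"
    using H by (rule continuous_on_subset) (auto simp: Q_def ca)
  ultimately have "bounded ((\<lambda>(p, x). H p x) ` Q)"
    by (intro compact_imp_bounded compact_continuous_image)
  then obtain B where B: "\<And>p x. (p, x) \<in> Q \<Longrightarrow> \<bar>H p x\<bar> \<le> B"
    unfolding bounded_iff by force
  have low: "- \<bar>B\<bar> \<le> H p x" if "x \<in> cbranch a" for p x
  proof (cases "R \<le> \<bar>p\<bar>")
    case True
    then show ?thesis using R[OF True that] by linarith
  next
    case False
    then have "(p, x) \<in> Q" using that by (auto simp: Q_def ca)
    from B[OF this] show ?thesis by linarith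
  qed
  have U: "branch_sc_super a H b g (\<lambda>x. \<bar>B\<bar>)"
    using low[of z] low[of 0] low ca r
    by (auto simp: branch_sc_super_def branch_super_def end_super_def Let_def z_def add_nonneg_nonneg
        algebra_simps split: end_cond.split) (smt (verit))+
  define L where "L = (case b of Neumann h \<Rightarrow> \<bar>h\<bar> | _ \<Rightarrow> 0)"
  have "L \<ge> 0" by (simp add: L_def split: end_cond.split)
  have "continuous_on {z..0} (\<lambda>x. H L x)"
    using continuous_on_compose2[OF H, of "{z..0}" "\<lambda>x. (L, x)"] ca
      continuous_on_Pair[OF continuous_on_const continuous_on_id, of "{z..0}" L]
    by auto
  then obtain N where N: "\<And>x. x \<in> {z..0} \<Longrightarrow> H L x \<le> N"
    using continuous_attains_sup[of "{z..0}" "\<lambda>x. H L x"] ca(3) by force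
  define M where "M = (case b of Dirichlet d \<Rightarrow> max N (- d) | _ \<Rightarrow> N)"
  have "N \<le> M" by (simp add: M_def split: end_cond.split)
  define v0 where "v0 x = L * x - M" for x
  have der: "(v0 has_real_derivative L) (at x within S)" for x S
    unfolding v0_def by (auto intro!: derivative_eq_intros)
  have v0: "branch_sub a H b g v0"
    unfolding branch_sub_def
  proof (intro conjI ballI allI impI)
    show "continuous_on (cbranch a) v0" unfolding v0_def by (intro continuous_intros)
    fix x p assume x: "x \<in> branch a" and p: "slope_above (branch a) v0 x p"
    have "p = L" by (rule slope_above_branch_derivative[OF a(1) x p der])
    moreover have "L * x \<le> 0" using x ca \<open>L \<ge> 0\<close> by (simp add: mult_nonneg_nonpos)
    moreover have "H L x \<le> M" using N[of x] x ca \<open>N \<le> M\<close> by simp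
    ultimately show "v0 x + H p x \<le> 0" by (simp add: v0_def)
  next
    have "L \<le> p" if "slope_above (insert z (branch a)) v0 z p" for p
      using slope_above_end_derivative[OF r(2) _ der] that r by (simp add: z_def)
    moreover have "L * z \<le> 0" using ca \<open>L \<ge> 0\<close> by (simp add: mult_nonneg_nonpos)
    ultimately show "end_sub a H b g v0"
      using r by (force simp: end_sub_def Let_def z_def[symmetric] v0_def L_def M_def
          split: end_cond.split)
  qed
  have below: "v 0 \<le> \<bar>B\<bar>" if "branch_sub a H b g v" for v
  proof -
    have "\<forall>x\<in>cbranch a. v x \<le> \<bar>B\<bar>"
      using comp that U unfolding branch_comparison_def branch_sc_super_def by blast
    then show ?thesis using zero_in_cbranch[OF a(1)] by blast
  qed
  have "v0 0 \<le> \<bar>B\<bar> + 1" using below[OF v0] by simp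
  from perron_solution[OF a(1) H coer comp v0 this U]
  obtain w where w: "branch_sub a H b g w" "w 0 < \<bar>B\<bar> + 1 \<Longrightarrow> branch_sc_super a H b g w"
    by metis
  then have "branch_sc_super a H b g w" using below[OF w(1)] by simp
  then show ?thesis using w(1) by (auto simp: branch_sc_solution_def)
qed

lemma branch_sub_minus_const:
  assumes "branch_sub a H b g v" "0 \<le> k"
  shows "branch_sub a H b g (\<lambda>x. v x - k)"
  unfolding branch_sub_def
proof (intro conjI ballI allI impI)
  show "continuous_on (cbranch a) (\<lambda>x. v x - k)"
    using assms by (auto simp: branch_sub_def intro: continuous_intros)
  show "v x - k + H p x \<le> 0" if "x \<in> branch a" "slope_above (branch a) (\<lambda>x. v x - k) x p" for x p
    using assms that slope_above_minus_const[OF that(2)] by (force simp: branch_sub_def)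
  show "end_sub a H b g (\<lambda>x. v x - k)"
  proof (cases "a = \<infinity>")
    case True
    have "\<forall>\<^sub>F x in at_bot. norm k \<le> \<bar>k\<bar> * norm (1 + \<bar>g x\<bar>)"
      by (intro always_eventually allI) (simp add: mult_le_cancel_left1)
    then have "(\<lambda>x. k) \<in> O[at_bot](\<lambda>x. 1 + \<bar>g x\<bar>)" by (rule bigoI)
    then show ?thesis
      using assms True by (auto simp: branch_sub_def end_sub_def intro: sum_in_bigo)
  next
    case False
    have "slope_above S v x p" if "slope_above S (\<lambda>x. v x - k) x p" for S x p
      using slope_above_minus_const[OF that] .
    then show ?thesis
      using assms False by (force simp: branch_sub_def end_sub_def Let_def split: end_cond.splits)
  qed
qed

text \<open>Lowering the state-constraint solution by a constant gives a sub-solution with the value \<open>c\<close>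
  at \<open>0\<close>. It starts Perron's method, and forces the supremum to attain the bound \<open>c\<close> there.\<close>

lemma branch_solution_with_junction_value:
  assumes a: "0 < a"
    and H: "continuous_on (UNIV \<times> cbranch a) (\<lambda>(p, x). H p x)"
    and coer: "coercive a H"
    and comp: "branch_comparison a H b g"
    and w: "branch_sc_solution a H b g w"
    and c: "c \<le> w 0"
  shows "\<exists>u. branch_sub a H b g u \<and> branch_super a H b g u \<and> u 0 = c"
proof -
  have sub: "branch_sub a H b g (\<lambda>x. w x - (w 0 - c))"
    using w c by (intro branch_sub_minus_const) (auto simp: branch_sc_solution_def)
  have sup: "branch_sc_super a H b g w" using w by (simp add: branch_sc_solution_def)
  obtain u where u: "branch_sub a H b g u" "branch_super a H b g u"
    "\<And>x. x \<in> cbranch a \<Longrightarrow> w x - (w 0 - c) \<le> u x" "u 0 \<le> c"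
    using perron_solution[OF a H coer comp sub _ sup, of c] by auto
  from u(3)[OF zero_in_cbranch[OF a]] u show ?thesis by auto
qed


section \<open>The junction\<close>

lemma axis_0 [simp]: "axis i (0 :: real) = 0"
  by (simp add: axis_def vec_eq_iff)

lemma norm_axis_real [simp]: "norm (axis i (x :: real)) = \<bar>x\<bar>"
  by (simp add: norm_eq_sqrt_inner inner_axis_axis)

lemma restr_0 [simp]: "restr u i 0 = u 0"
  by (simp add: restr_def)

lemma junction_component:
  fixes a :: "'k::finite \<Rightarrow> ereal"
  assumes "\<And>i. 0 < a i" "y \<in> junction a"
  shows "y $ i \<in> cbranch (a i)"
  using assms(2) zero_in_cbranch[OF assms(1)] by (auto simp: junction_def axis_def)

text \<open>As there are finitely many branches, a common radius works for all of them.\<close>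

lemma eventually_at_junction:
  fixes a :: "'k::finite \<Rightarrow> ereal"
  assumes a: "\<And>i. 0 < a i"
  shows "(\<forall>\<^sub>F y in at 0 within junction a. P y) \<longleftrightarrow>
    (\<forall>i. \<forall>\<^sub>F x in at 0 within insert 0 (branch (a i)). P (axis i x))"
proof (intro iffI allI)
  fix i assume "\<forall>\<^sub>F y in at 0 within junction a. P y"
  then obtain d where d: "d > 0" "\<And>y. y \<in> junction a \<Longrightarrow> y \<noteq> 0 \<Longrightarrow> norm y < d \<Longrightarrow> P y"
    unfolding eventually_at by auto
  have "axis i x \<in> junction a" if "x \<in> insert 0 (branch (a i))" for x
    using that branch_subset_cbranch zero_in_cbranch[OF a] by (auto simp: junction_def)
  then show "\<forall>\<^sub>F x in at 0 within insert 0 (branch (a i)). P (axis i x)"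
    unfolding eventually_at using d by (intro exI[of _ d]) (auto simp: axis_eq_0_iff)
next
  assume *: "\<forall>i. \<forall>\<^sub>F x in at 0 within insert 0 (branch (a i)). P (axis i x)"
  have "\<exists>d>0. \<forall>x\<in>cbranch (a i). x \<noteq> 0 \<and> \<bar>x\<bar> < d \<longrightarrow> P (axis i x)" for i
  proof -
    obtain d where d: "d > 0"
      "\<And>x. x \<in> insert 0 (branch (a i)) \<Longrightarrow> x \<noteq> 0 \<Longrightarrow> \<bar>x\<bar> < d \<Longrightarrow> P (axis i x)"
      using *[rule_format, of i] unfolding eventually_at by auto
    obtain r where r: "r > 0" "\<And>x. x \<in> cbranch (a i) \<Longrightarrow> \<bar>x\<bar> \<le> r \<Longrightarrow> x \<in> insert 0 (branch (a i))"
      using cbranch_near[OF a[of i] zero_in_cbranch[OF a]] by auto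
    have "P (axis i x)" if "x \<in> cbranch (a i)" "x \<noteq> 0 \<and> \<bar>x\<bar> < min d r" for x
      using that by (intro d(2)[OF r(2)]) auto
    then show ?thesis using d(1) r(1) by (intro exI[of _ "min d r"]) auto
  qed
  then obtain d where d: "\<And>i. d i > 0"
    "\<And>i x. x \<in> cbranch (a i) \<Longrightarrow> x \<noteq> 0 \<Longrightarrow> \<bar>x\<bar> < d i \<Longrightarrow> P (axis i x)"
    by metis
  have "P y" if y: "y \<in> junction a" "y \<noteq> 0" "norm y < Min (range d)" for y
  proof -
    obtain i x where x: "y = axis i x" "x \<in> cbranch (a i)" using y(1) by (auto simp: junction_def)
    have "Min (range d) \<le> d i" by (intro Min_le) auto
    then show ?thesis using d(2)[of x i] x y by auto
  qed
  moreover have "0 < Min (range d)" using d(1) by simp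
  ultimately show "\<forall>\<^sub>F y in at 0 within junction a. P y"
    unfolding eventually_at by (intro exI[of _ "Min (range d)"]) auto
qed

lemma glue_branches:
  fixes a :: "'k::finite \<Rightarrow> ereal" and f :: "'k \<Rightarrow> real \<Rightarrow> real"
  assumes "\<And>i. 0 < a i" "\<And>i. continuous_on (cbranch (a i)) (f i)" "\<And>i. f i 0 = c"
  obtains u :: "real ^ 'k \<Rightarrow> real"
    where "continuous_on (junction a) u" "\<And>i. restr u i = f i" "u 0 = c"
proof -
  \<comment> \<open>On the \<open>i\<close>-th axis all components but the \<open>i\<close>-th vanish, and the other terms are \<open>f j 0 - c = 0\<close>.\<close>
  define u where "u y = c + (\<Sum>i\<in>UNIV. f i (y $ i) - c)" for y :: "real ^ 'k"
  have "continuous_on (junction a) (\<lambda>y. f i (y $ i))" for i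
    using junction_component[of a] assms(1)
    by (intro continuous_on_compose2[OF assms(2)] continuous_intros) auto
  then have "continuous_on (junction a) u"
    unfolding u_def by (intro continuous_intros)
  moreover have "restr u i = f i" for i
  proof
    fix x
    have "f j (axis i x $ j) - c = (if j = i then f i x - c else 0)" for j
      using assms(3) by (simp add: axis_def)
    then show "restr u i x = f i x" by (simp add: restr_def u_def)
  qed
  moreover have "u 0 = c" using assms(3) by (simp add: u_def)
  ultimately show thesis using that by blast
qed

text \<open>Test functions at \<open>0\<close> on one branch live on \<open>insert 0 (branch a)\<close> and may be discontinuous at
  the outer end point, whereas those on the junction must be continuous up to there. So
  the test function is replaced by its tangent line to the left of a point \<open>m\<close> near \<open>0\<close>. It is also
  shifted to take the value \<open>u 0\<close>, so that different branches match.\<close>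

lemma slope_below_continuous_test:
  assumes a: "0 < a" and slope: "slope_below (insert 0 (branch a)) u 0 p"
  obtains \<phi> \<phi>' where "C1_on (insert 0 (branch a)) \<phi> \<phi>'" "continuous_on (cbranch a) \<phi>"
    "\<phi>' 0 = p" "\<phi> 0 = u 0"
    "\<forall>\<^sub>F y in at 0 within insert 0 (branch a). \<phi> y \<le> u y"
proof -
  define S where "S = insert 0 (branch a)"
  obtain \<phi>0 \<phi>0' where C1: "C1_on S \<phi>0 \<phi>0'" "\<phi>0' 0 = p"
    and ev: "\<forall>\<^sub>F y in at 0 within S. u y - \<phi>0 y \<ge> u 0 - \<phi>0 0"
    using slope by (auto simp: slope_below_def S_def)
  obtain l where l: "l < 0" "{l<..<0} \<subseteq> branch a"
    using cbranch_left_interval[OF a zero_in_cbranch[OF a]] by metis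
  define m where "m = l / 2"
  have m: "m < 0" "l < m" using l by (auto simp: m_def)
  have mS: "max x m \<in> S" if "x \<le> 0" for x
    using l(2) m that by (cases "max x m = 0") (auto simp: S_def max_def)
  have S0: "x \<le> 0" if "x \<in> S" for x using that by (auto simp: S_def branch_def)
  \<comment> \<open>The last term is \<open>0\<close> for \<open>x \<ge> m\<close>, where \<open>max x m = x\<close>.\<close>
  define \<phi> where "\<phi> x = u 0 - \<phi>0 0 + \<phi>0 (max x m) + \<phi>0' m * (min x m - m)" for x
  define \<phi>' where "\<phi>' x = \<phi>0' (max x m)" for x
  have right: "\<phi> x = u 0 - \<phi>0 0 + \<phi>0 x" if "m \<le> x" for x
    using that by (simp add: \<phi>_def max_def min_def)
  have left: "\<phi> x = u 0 - \<phi>0 0 + \<phi>0 m + \<phi>0' m * (x - m)" if "x \<le> m" for x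
    using that by (simp add: \<phi>_def max_def min_def)
  have der0: "((\<lambda>x. u 0 - \<phi>0 0 + \<phi>0 x) has_real_derivative \<phi>0' x) (at x within S)" if "x \<in> S" for x
    using C1 that by (auto simp: C1_on_def intro!: derivative_eq_intros)
  have derl: "((\<lambda>x. u 0 - \<phi>0 0 + \<phi>0 m + \<phi>0' m * (x - m)) has_real_derivative \<phi>0' m)
      (at x within T)" for x T
    by (auto intro!: derivative_eq_intros)
  have "(\<phi> has_real_derivative \<phi>' x) (at x within S)" if x: "x \<in> S" for x
  proof (cases x m rule: linorder_cases)
    case less
    have "(\<phi> has_real_derivative \<phi>0' m) (at x within S)"
      by (rule has_field_derivative_transform_within[OF derl, of "m - x"])
        (use less x left in \<open>auto simp: dist_real_def\<close>)
    then show ?thesis using less by (simp add: \<phi>'_def)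
  next
    case greater
    have "(\<phi> has_real_derivative \<phi>0' x) (at x within S)"
      by (rule has_field_derivative_transform_within[OF der0, of _ "x - m"])
        (use greater x right in \<open>auto simp: dist_real_def\<close>)
    then show ?thesis using greater by (simp add: \<phi>'_def)
  next
    case equal
    have "m \<in> branch a" using l m by auto
    then have "at m within S = at m"
      using open_branch[OF a] by (intro at_within_open_subset[of _ "branch a"]) (auto simp: S_def)
    then have "((\<lambda>x. u 0 - \<phi>0 0 + \<phi>0 x) has_real_derivative \<phi>0' m) (at m)"
      using der0 x equal by metis
    then have lim_r: "((\<lambda>x. (u 0 - \<phi>0 0 + \<phi>0 x - (u 0 - \<phi>0 0 + \<phi>0 m)) / (x - m)) \<longlongrightarrow> \<phi>0' m) (at_right m)"
      unfolding has_field_derivative_iff by (rule tendsto_mono[OF at_le[OF subset_UNIV]])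
    have lim_l: "((\<lambda>x. (u 0 - \<phi>0 0 + \<phi>0 m + \<phi>0' m * (x - m) -
        (u 0 - \<phi>0 0 + \<phi>0 m + \<phi>0' m * (m - m))) / (x - m)) \<longlongrightarrow> \<phi>0' m) (at_left m)"
      using derl[of m "{..<m}"] unfolding has_field_derivative_iff .
    have "((\<lambda>x. (\<phi> x - \<phi> m) / (x - m)) \<longlongrightarrow> \<phi>0' m) (at_left m)"
      by (rule Lim_transform_eventually[OF lim_l])
        (use left in \<open>auto simp: eventually_at_filter\<close>)
    moreover have "((\<lambda>x. (\<phi> x - \<phi> m) / (x - m)) \<longlongrightarrow> \<phi>0' m) (at_right m)"
      by (rule Lim_transform_eventually[OF lim_r])
        (use right in \<open>auto simp: eventually_at_filter\<close>)
    ultimately have "(\<phi> has_real_derivative \<phi>0' m) (at m)"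
      unfolding has_field_derivative_iff by (rule filterlim_split_at)
    then show ?thesis
      using equal by (auto simp: \<phi>'_def intro: has_field_derivative_at_within)
  qed
  moreover have "continuous_on S \<phi>0'" using C1 by (simp add: C1_on_def)
  then have "continuous_on S \<phi>'"
    unfolding \<phi>'_def
    by (rule continuous_on_compose2) (auto intro!: continuous_intros mS S0)
  ultimately have "C1_on S \<phi> \<phi>'" by (simp add: C1_on_def)
  moreover have "continuous_on (cbranch a) (\<lambda>x. \<phi>0 (max x m))"
    by (rule continuous_on_compose2[OF C1_on_continuous_on[OF C1(1)]])
      (auto simp: cbranch_def intro!: continuous_intros mS)
  then have "continuous_on (cbranch a) \<phi>"
    unfolding \<phi>_def by (intro continuous_intros)
  moreover have "\<phi>' 0 = p" "\<phi> 0 = u 0" using m C1(2) right[of 0] by (auto simp: \<phi>'_def)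
  moreover have "\<forall>\<^sub>F y in at 0 within S. m < y"
    unfolding eventually_at using m by (intro exI[of _ "- m"]) (auto simp: dist_real_def)
  then have "\<forall>\<^sub>F y in at 0 within S. \<phi> y \<le> u y"
    using ev by eventually_elim (use right in force)
  ultimately show thesis using that unfolding S_def by blast
qed

text \<open>The heart of the matter: a super-solution that lies below every state-constraint solution at
  the junction is a state-constraint super-solution on no branch, and the failing test functions
  glue to one that contradicts the junction condition, because the maximum of finitely many
  numbers below \<open>- u 0\<close> is below \<open>- u 0\<close>.\<close>

lemma junction_super_ge_some_branch:
  fixes a :: "'k::finite \<Rightarrow> ereal"
  assumes a: "\<And>i. 0 < a i"
    and comp: "\<And>i. branch_comparison (a i) (H i) (b i) (g i)"
    and usc: "\<And>i. branch_sc_solution (a i) (H i) (b i) (g i) (usc i)"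
    and u: "junction_super a H b g u"
  shows "\<exists>i. usc i 0 \<le> u 0"
proof (rule ccontr)
  assume "\<not> ?thesis"
  then have below: "u 0 < usc i 0" for i by (simp add: not_le)
  define P where "P i \<phi> \<phi>' \<longleftrightarrow> C1_on (insert 0 (branch (a i))) \<phi> \<phi>' \<and>
    continuous_on (cbranch (a i)) \<phi> \<and> \<phi> 0 = u 0 \<and> u 0 + H i (\<phi>' 0) 0 < 0 \<and>
    (\<forall>\<^sub>F y in at 0 within insert 0 (branch (a i)). \<phi> y \<le> restr u i y)" for i \<phi> \<phi>'
  have "\<exists>\<phi> \<phi>'. P i \<phi> \<phi>'" for i
  proof -
    have "\<not> branch_sc_super (a i) (H i) (b i) (g i) (restr u i)"
    proof
      assume "branch_sc_super (a i) (H i) (b i) (g i) (restr u i)"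
      then have "\<forall>x\<in>cbranch (a i). usc i x \<le> restr u i x"
        using comp[of i] usc[of i]
        unfolding branch_comparison_def branch_sc_solution_def branch_sc_super_def by blast
      then show False using zero_in_cbranch[OF a, of i] below[of i] by force
    qed
    then obtain p where p: "slope_below (insert 0 (branch (a i))) (restr u i) 0 p"
      and neg: "u 0 + H i p 0 < 0"
      using u by (auto simp: branch_sc_super_def junction_super_def not_le)
    show ?thesis
    proof (rule slope_below_continuous_test[OF a p])
      fix \<phi> \<phi>'
      assume *: "C1_on (insert 0 (branch (a i))) \<phi> \<phi>'" "continuous_on (cbranch (a i)) \<phi>"
        "\<phi> 0 = restr u i 0" "\<forall>\<^sub>F y in at 0 within insert 0 (branch (a i)). \<phi> y \<le> restr u i y"
        and "\<phi>' 0 = p"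
      then have "P i \<phi> \<phi>'" using neg by (simp add: P_def)
      then show ?thesis by blast
    qed
  qed
  then obtain \<phi> \<phi>' where "\<And>i. P i (\<phi> i) (\<phi>' i)" by metis
  then have C1: "\<And>i. C1_on (insert 0 (branch (a i))) (\<phi> i) (\<phi>' i)"
    and cont: "\<And>i. continuous_on (cbranch (a i)) (\<phi> i)" and \<phi>0: "\<And>i. \<phi> i 0 = u 0"
    and neg: "\<And>i. u 0 + H i (\<phi>' i 0) 0 < 0"
    and ev: "\<And>i. \<forall>\<^sub>F y in at 0 within insert 0 (branch (a i)). \<phi> i y \<le> restr u i y"
    by (simp_all add: P_def)
  obtain \<Phi> :: "real ^ 'k \<Rightarrow> real" where
    \<Phi>: "continuous_on (junction a) \<Phi>" "\<And>i. restr \<Phi> i = \<phi> i" "\<Phi> 0 = u 0"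
    by (rule glue_branches[of a \<phi>, OF a cont \<phi>0]) blast
  have "\<forall>\<^sub>F x in at 0 within insert 0 (branch (a i)). u (axis i x) - \<Phi> (axis i x) \<ge> u 0 - \<Phi> 0" for i
    using ev[of i] by eventually_elim (simp add: \<Phi>(3) \<Phi>(2)[symmetric] restr_def)
  then have "\<forall>\<^sub>F y in at 0 within junction a. u y - \<Phi> y \<ge> u 0 - \<Phi> 0"
    by (simp add: eventually_at_junction[OF a])
  moreover have "\<forall>i. C1_on (insert 0 (branch (a i))) (restr \<Phi> i) (\<phi>' i)" using C1 \<Phi>(2) by simp
  ultimately have "u 0 + (MAX i. H i (\<phi>' i 0) 0) \<ge> 0"
    using u \<Phi>(1) unfolding junction_super_def by blast
  moreover have "(MAX i. H i (\<phi>' i 0) 0) < - u 0"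
  proof (subst Max_less_iff)
    have "H i (\<phi>' i 0) 0 < - u 0" for i using neg[of i] by linarith
    then show "\<forall>k\<in>range (\<lambda>i. H i (\<phi>' i 0) 0). k < - u 0" by blast
  qed auto
  ultimately show False by linarith
qed

theorem theorem2p1:
  fixes a :: "'k::finite \<Rightarrow> ereal"
    and H :: "'k \<Rightarrow> real \<Rightarrow> real \<Rightarrow> real"
    and b :: "'k \<Rightarrow> end_cond"
    and g :: "'k \<Rightarrow> real \<Rightarrow> real"
  assumes "\<And>i. a i > 0"
    and "\<And>i. continuous_on (UNIV \<times> cbranch (a i)) (\<lambda>(p, x). H i p x)"
    and "\<And>i. branch_comparison (a i) (H i) (b i) (g i)"
    and "\<And>i. a i = \<infinity> \<Longrightarrow> \<exists>w. branch_sc_solution (a i) (H i) (b i) (g i) w"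
    and "\<And>i. coercive (a i) (H i)"
  shows "(\<forall>v u. junction_sub a H b g v \<and> junction_super a H b g u \<longrightarrow>
            (\<forall>x\<in>junction a. v x \<le> u x)) \<and>
         (\<exists>uhat. junction_solution a H b g uhat \<and>
            (\<forall>u. junction_solution a H b g u \<longrightarrow> (\<forall>x\<in>junction a. u x = uhat x))) \<and>
         (\<forall>i. \<exists>w. branch_sc_solution (a i) (H i) (b i) (g i) w) \<and>
         (\<forall>uhat usc. junction_solution a H b g uhat \<and>
            (\<forall>i. branch_sc_solution (a i) (H i) (b i) (g i) (usc i)) \<longrightarrow>
            uhat 0 = (MIN i. usc i 0))"
proof -
  note a = assms(1) and H = assms(2) and comp = assms(3) and coer = assms(5)
  have ex: "\<exists>w. branch_sc_solution (a i) (H i) (b i) (g i) w" for i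
    using assms(4) branch_sc_solution_exists[OF a _ H coer comp] by blast
  have sub_le: "v 0 \<le> usc 0"
    if "junction_sub a H b g v" "branch_sc_solution (a i) (H i) (b i) (g i) usc" for v usc i
  proof -
    have "\<forall>x\<in>cbranch (a i). restr v i x \<le> usc x"
      using that comp[of i]
      unfolding branch_comparison_def branch_sc_solution_def branch_sc_super_def junction_sub_def
      by blast
    then show ?thesis using zero_in_cbranch[OF a] by force
  qed
  obtain usc where usc: "\<And>i. branch_sc_solution (a i) (H i) (b i) (g i) (usc i)"
    using ex by metis
  have comparison: "v x \<le> u x"
    if v: "junction_sub a H b g v" and u: "junction_super a H b g u" and x: "x \<in> junction a" for v u x
  proof -
    obtain j where "usc j 0 \<le> u 0"
      using junction_super_ge_some_branch[where H = H, OF a comp usc u] by blast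
    then have 0: "v 0 \<le> u 0" using sub_le[OF v usc] by (meson order_trans)
    obtain i t where t: "x = axis i t" "t \<in> cbranch (a i)" using x by (auto simp: junction_def)
    have "\<forall>t\<in>cbranch (a i). restr v i t \<le> restr u i t"
      using comp[of i] u v 0
      unfolding branch_comparison_def junction_sub_def junction_super_def by simp
    then show ?thesis using t by (simp add: restr_def)
  qed
  define c where "c = (MIN i. usc i 0)"
  have "c \<in> range (\<lambda>i. usc i 0)" unfolding c_def by (intro Min_in) auto
  then obtain k where k: "usc k 0 = c" by auto
  have c_le: "c \<le> usc i 0" for i unfolding c_def by (intro Min_le) auto
  \<comment> \<open>The branch \<open>k\<close>, where the minimum is attained, is kept as it is; it alone will be responsible for
    the super-solution property at the junction.\<close>
  have "\<exists>w. branch_sub (a i) (H i) (b i) (g i) w \<and> branch_super (a i) (H i) (b i) (g i) w \<and>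
      w 0 = c \<and> (i = k \<longrightarrow> branch_sc_super (a i) (H i) (b i) (g i) w)" for i
  proof (cases "i = k")
    case True
    then show ?thesis using usc[of k] k by (auto simp: branch_sc_solution_def branch_sc_super_def)
  next
    case False
    then show ?thesis
      using branch_solution_with_junction_value[OF a H coer comp usc c_le] by blast
  qed
  then obtain W where W: "\<And>i. branch_sub (a i) (H i) (b i) (g i) (W i)"
    "\<And>i. branch_super (a i) (H i) (b i) (g i) (W i)" "\<And>i. W i 0 = c"
    "branch_sc_super (a k) (H k) (b k) (g k) (W k)"
    by metis
  have Wc: "\<And>i. continuous_on (cbranch (a i)) (W i)" using W(1) by (simp add: branch_sub_def)
  obtain uhat :: "real ^ 'k \<Rightarrow> real" where
    uhat: "continuous_on (junction a) uhat" "\<And>i. restr uhat i = W i" "uhat 0 = c"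
    by (rule glue_branches[of a W, OF a Wc W(3)]) blast
  have "junction_super a H b g uhat"
    unfolding junction_super_def
  proof (intro conjI allI impI)
    fix \<phi> :: "real ^ 'k \<Rightarrow> real" and \<phi>' :: "'k \<Rightarrow> real \<Rightarrow> real"
    assume *: "continuous_on (junction a) \<phi> \<and>
      (\<forall>i. C1_on (insert 0 (branch (a i))) (restr \<phi> i) (\<phi>' i)) \<and>
      (\<forall>\<^sub>F y in at 0 within junction a. uhat 0 - \<phi> 0 \<le> uhat y - \<phi> y)"
    then have "\<forall>\<^sub>F x in at 0 within insert 0 (branch (a k)). W k 0 - restr \<phi> k 0 \<le> W k x - restr \<phi> k x"
      by (simp add: eventually_at_junction[OF a] uhat(2)[symmetric]) (simp add: restr_def)
    then have "slope_below (insert 0 (branch (a k))) (W k) 0 (\<phi>' k 0)"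
      using * unfolding slope_below_def by blast
    then have "0 \<le> c + H k (\<phi>' k 0) 0" using W(3,4) by (auto simp: branch_sc_super_def)
    also have "H k (\<phi>' k 0) 0 \<le> (MAX i. H i (\<phi>' i 0) 0)" by (intro Max_ge) auto
    finally show "0 \<le> uhat 0 + (MAX i. H i (\<phi>' i 0) 0)" using uhat(3) by simp
  qed (use uhat W in auto)
  then have sol: "junction_solution a H b g uhat"
    using uhat W by (simp add: junction_solution_def junction_sub_def)
  have unique: "u x = uhat x" if "junction_solution a H b g u" "x \<in> junction a" for u x
    using comparison sol that by (meson antisym junction_solution_def)
  have junction_value: "u 0 = (MIN i. usc i 0)"
    if u: "junction_solution a H b g u"
      and usc: "\<And>i. branch_sc_solution (a i) (H i) (b i) (g i) (usc i)" for u usc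
  proof (rule antisym)
    have "\<And>i. u 0 \<le> usc i 0" using u usc sub_le by (auto simp: junction_solution_def)
    then show "u 0 \<le> (MIN i. usc i 0)" by (intro Min.boundedI) auto
    obtain i where "usc i 0 \<le> u 0"
      using junction_super_ge_some_branch[where H = H, OF a comp usc] u
      unfolding junction_solution_def by blast
    moreover have "(MIN i. usc i 0) \<le> usc i 0" by (intro Min_le) auto
    ultimately show "(MIN i. usc i 0) \<le> u 0" by linarith
  qed
  show ?thesis using comparison sol unique ex junction_value by blast
qed

end
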